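(* There is a deterministic polynomial-time algorithm that, given as input an $n$-vertex connected graph $G=(V,E)$ with $\mathrm{AC}(G)=1$, outputs a strategy for acquaintance in $G$ consisting of $n-1$ rounds (matchings).
   Context: Acquaintance time: let $G=(V,E)$ be a finite, simple, undirected, connected graph, and place one agent on each vertex. Two agents are acquainted once they occupy the two endpoints of a common edge at some time (including the initial placement). In each round one chooses a matching $M$ of $G$ (any set of pairwise vertex-disjoint edges, not necessarily maximal), and for every edge of $M$ the two agents on its endpoints swap places; after each round, agents on adjacent vertices again become acquainted. A strategy is a finite sequence of matchings; a strategy for acquaintance is one after which every pair of agents has been acquainted. $\mathrm{AC}(G)$ is the minimum number of rounds in a strategy for acquaintance in $G$. *)

theory Defs
  imports "HOL-Library.Extended_Nat" "HOL-Computational_Algebra.Polynomial"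
begin

section \<open>Acquaintance time\<close>

definition simple_graph :: "'a set \<Rightarrow> 'a set set \<Rightarrow> bool" where
  "simple_graph V E \<longleftrightarrow> finite V \<and> (\<forall>e\<in>E. \<exists>u\<in>V. \<exists>v\<in>V. u \<noteq> v \<and> e = {u, v})"

definition connected_graph :: "'a set \<Rightarrow> 'a set set \<Rightarrow> bool" where
  "connected_graph V E \<longleftrightarrow>
     V \<noteq> {} \<and> (\<forall>u\<in>V. \<forall>v\<in>V. (u, v) \<in> {(x, y). {x, y} \<in> E}\<^sup>*)"

definition graph_matching :: "'a set set \<Rightarrow> 'a set set \<Rightarrow> bool" where
  "graph_matching E M \<longleftrightarrow> M \<subseteq> E \<and> pairwise disjnt M"

definition swap_along :: "'a set set \<Rightarrow> 'a \<Rightarrow> 'a" where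
  "swap_along M x = (if \<exists>y. {x, y} \<in> M then THE y. {x, y} \<in> M else x)"

text \<open>An agent is identified with its initial vertex: \<open>position Ms a\<close> is the vertex occupied,
  after the rounds \<open>Ms\<close> (head first), by the agent that started on \<open>a\<close>.\<close>

definition position :: "'a set set list \<Rightarrow> 'a \<Rightarrow> 'a" where
  "position Ms a = fold swap_along Ms a"

definition acquainted :: "'a set set \<Rightarrow> 'a set set list \<Rightarrow> 'a \<Rightarrow> 'a \<Rightarrow> bool" where
  "acquainted E Ms a b \<longleftrightarrow>
     (\<exists>k\<le>length Ms. {position (take k Ms) a, position (take k Ms) b} \<in> E)"

definition acquaintance_strategy :: "'a set \<Rightarrow> 'a set set \<Rightarrow> 'a set set list \<Rightarrow> bool" where
  "acquaintance_strategy V E Ms \<longleftrightarrow>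
     (\<forall>M\<in>set Ms. graph_matching E M) \<and>
     (\<forall>a\<in>V. \<forall>b\<in>V. a \<noteq> b \<longrightarrow> acquainted E Ms a b)"

text \<open>The infimum in \<^typ>\<open>enat\<close> is a minimum whenever a strategy exists, and \<open>\<infinity>\<close> otherwise.\<close>

definition AC :: "'a set \<Rightarrow> 'a set set \<Rightarrow> enat" where
  "AC V E = (INF Ms\<in>{Ms. acquaintance_strategy V E Ms}. enat (length Ms))"


section \<open>Random access machines\<close>

text \<open>The random access machine of Cook and Reckhow, with an input tape that is read from left
  to right, an output tape that is written from left to right, and registers
  \<open>0, 1, 2, \<dots>\<close> holding natural numbers. Every executed instruction costs one time unit. Sums
  and differences are the only arithmetic, so the maximal bit length among the inputs, the
  constants of the program and the registers grows by at most one per step; unit cost is therefore polynomially related to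
  logarithmic cost and to Turing machine time.\<close>

datatype instr =
    Const nat nat     \<comment> \<open>\<open>R i := c\<close>\<close>
  | Add nat nat nat   \<comment> \<open>\<open>R i := R j + R k\<close>\<close>
  | Sub nat nat nat   \<comment> \<open>\<open>R i := R j - R k\<close>, truncated at 0\<close>
  | Load nat nat      \<comment> \<open>\<open>R i := R (R j)\<close>\<close>
  | Store nat nat     \<comment> \<open>\<open>R (R i) := R j\<close>\<close>
  | Jump nat
  | JumpZero nat nat  \<comment> \<open>go to the second argument if \<open>R i = 0\<close>\<close>
  | Read nat          \<comment> \<open>\<open>R i := next input\<close>, which is 0 past the end of the input\<close>
  | Write nat         \<comment> \<open>append \<open>R i\<close> to the output\<close>

record config =
  pc :: nat
  reg :: "nat \<Rightarrow> nat"
  inp :: "nat list"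
  outp :: "nat list"

definition init_config :: "nat list \<Rightarrow> config" where
  "init_config x = \<lparr>pc = 0, reg = (\<lambda>_. 0), inp = x, outp = []\<rparr>"

definition set_reg :: "nat \<Rightarrow> nat \<Rightarrow> config \<Rightarrow> config" where
  "set_reg i v c = c\<lparr>pc := pc c + 1, reg := (reg c)(i := v)\<rparr>"

fun exec_instr :: "instr \<Rightarrow> config \<Rightarrow> config" where
  "exec_instr (Const i v) c = set_reg i v c"
| "exec_instr (Add i j k) c = set_reg i (reg c j + reg c k) c"
| "exec_instr (Sub i j k) c = set_reg i (reg c j - reg c k) c"
| "exec_instr (Load i j) c = set_reg i (reg c (reg c j)) c"
| "exec_instr (Store i j) c = set_reg (reg c i) (reg c j) c"
| "exec_instr (Jump l) c = c\<lparr>pc := l\<rparr>"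
| "exec_instr (JumpZero i l) c = c\<lparr>pc := (if reg c i = 0 then l else pc c + 1)\<rparr>"
| "exec_instr (Read i) c =
     (case inp c of [] \<Rightarrow> set_reg i 0 c | v # vs \<Rightarrow> (set_reg i v c)\<lparr>inp := vs\<rparr>)"
| "exec_instr (Write i) c = c\<lparr>pc := pc c + 1, outp := outp c @ [reg c i]\<rparr>"

definition halted :: "instr list \<Rightarrow> config \<Rightarrow> bool" where
  "halted P c \<longleftrightarrow> length P \<le> pc c"

definition step :: "instr list \<Rightarrow> config \<Rightarrow> config" where
  "step P c = (if halted P c then c else exec_instr (P ! pc c) c)"

definition run :: "instr list \<Rightarrow> nat list \<Rightarrow> nat \<Rightarrow> config" where
  "run P x t = (step P ^^ t) (init_config x)"

text \<open>The input size is measured by the number of entries of the input. It never exceeds the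
  number of bits needed to write the entries down, so the bound below is also polynomial
  in the bit length.\<close>

definition poly_time_on :: "instr list \<Rightarrow> nat list set \<Rightarrow> bool" where
  "poly_time_on P I \<longleftrightarrow>
     (\<exists>p :: nat poly. \<forall>x\<in>I. \<exists>t\<le>poly p (length x). halted P (run P x t))"

definition outputs :: "instr list \<Rightarrow> nat list \<Rightarrow> nat list \<Rightarrow> bool" where
  "outputs P x y \<longleftrightarrow> (\<exists>t. halted P (run P x t) \<and> outp (run P x t) = y)"


section \<open>Encoding graphs and strategies\<close>

text \<open>A graph on the vertices \<open>0, \<dots>, n - 1\<close> is given by \<open>n\<close> and its adjacency matrix, row by row.\<close>

definition encode_graph :: "nat \<Rightarrow> nat set set \<Rightarrow> nat list" where
  "encode_graph n E =
     n # concat (map (\<lambda>i. map (\<lambda>j. if {i, j} \<in> E then 1 else 0) [0..<n]) [0..<n])"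

text \<open>A round is given by a list of its edges, each listed by its two endpoints.\<close>

definition round_matching :: "(nat \<times> nat) list \<Rightarrow> nat set set" where
  "round_matching es = (\<lambda>(u, v). {u, v}) ` set es"

definition encode_round :: "(nat \<times> nat) list \<Rightarrow> nat list" where
  "encode_round es = length es # concat (map (\<lambda>(u, v). [u, v]) es)"

definition encode_strategy :: "(nat \<times> nat) list list \<Rightarrow> nat list" where
  "encode_strategy rs = length rs # concat (map encode_round rs)"

end

theory Submission
  imports Defs
begin

text \<open>Let \<open>\<sigma>\<close> be the involution of the single round. Of any two agents \<open>a \<noteq> b\<close>, either \<open>a, b\<close> or
  \<open>\<sigma> a, \<sigma> b\<close> are adjacent, so \<open>deg u + deg (\<sigma> u) \<ge> n - 1\<close>: vertices of small degree are matched by as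
  many vertices of large degree. As in the theorems of Chvatal and of Bondy and Chvatal, this yields
  for every nonadjacent pair \<open>u, v\<close> at least \<open>n - 1\<close> pairs at \<open>u\<close> or \<open>v\<close> that are edges or have a larger
  degree sum than \<open>u, v\<close>. Hence in a cyclic order of the vertices and one additional universal vertex,
  a consecutive nonadjacent pair of least degree sum can be removed by reversing a segment, without
  creating another pair of that degree sum or less. Treating the degree sums in increasing
  order takes polynomially many reversals and ends with a Hamiltonian path. Odd-even transposition
  along it acquaints all agents in \<open>n - 1\<close> rounds.

  The random access machine is programmed in a small language with arrays and bounded loops,
  whose running time is bounded by a polynomial that depends only on the program text.\<close>


section \<open>A loop language and its compilation\<close>

text \<open>The count \<open>n - 1\<close> is exactly what the exchange needs. The universal vertex
  is a heavy partner of both ends of a bad pair, so among the \<open>N = n + 1\<close> tour vertices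
  the two ends have at least \<open>N\<close> heavy partners in total, while only
  \<open>N - 1\<close> positions differ from that of the bad pair. Hence some position serves both
  ends, which is Ore's crossing argument. Closure edges would have to be undone again; weights taken
  from the given graph never change, so a cleared level stays cleared, and once all levels below the
  weight of an edge are cleared, every consecutive pair is an edge. The machine has neither
  multiplication nor division. Addresses are therefore scaled by doubling, and row offsets and
  parities are kept in tables. All loop lengths are linear in \<open>n\<close>, so the program stops
  in polynomial time on every graph, whatever its acquaintance time.\<close>

datatype exp =
    Num nat
  | Size
  | Arr nat exp
  | Plus exp exp
  | Minus exp exp

datatype com =
    Skip
  | Assign nat exp exp
  | Seq com com  (infixr \<open>;;\<close> 60)
  | Cond exp com com
  | For nat nat nat com
  | Get nat
  | Put exp

abbreviation Var :: "nat \<Rightarrow> exp" where "Var x \<equiv> Arr x (Num 0)"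
abbreviation Set :: "nat \<Rightarrow> exp \<Rightarrow> com" where "Set x \<equiv> Assign x (Num 0)"
abbreviation When :: "exp \<Rightarrow> com \<Rightarrow> com" where "When e c \<equiv> Cond e c Skip"

record state =
  mem :: "nat \<Rightarrow> nat \<Rightarrow> nat"
  unread :: "nat list"
  written :: "nat list"

definition put :: "nat \<Rightarrow> nat \<Rightarrow> nat \<Rightarrow> state \<Rightarrow> state" where
  "put a i v s = s\<lparr>mem := (mem s)(a := (mem s a)(i := v))\<rparr>"

fun eval :: "nat \<Rightarrow> exp \<Rightarrow> state \<Rightarrow> nat" where
  "eval n (Num c) s = c"
| "eval n Size s = n"
| "eval n (Arr a e) s = mem s a (eval n e s)"
| "eval n (Plus e f) s = eval n e s + eval n f s"
| "eval n (Minus e f) s = eval n e s - eval n f s"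

fun exec :: "nat \<Rightarrow> com \<Rightarrow> state \<Rightarrow> state" where
  "exec n Skip s = s"
| "exec n (Assign a e f) s = put a (eval n e s) (eval n f s) s"
| "exec n (c ;; d) s = exec n d (exec n c s)"
| "exec n (Cond e c d) s = (if eval n e s \<noteq> 0 then exec n c s else exec n d s)"
| "exec n (For x a b c) s = fold (\<lambda>i s. exec n c (put x 0 i s)) [0..<a * n + b] s"
| "exec n (Get x) s =
     (case unread s of [] \<Rightarrow> put x 0 0 s | v # vs \<Rightarrow> (put x 0 v s)\<lparr>unread := vs\<rparr>)"
| "exec n (Put e) s = s\<lparr>written := written s @ [eval n e s]\<rparr>"

text \<open>Cell \<open>i\<close> of array \<open>a < 30\<close> is kept in register \<open>32 * i + a\<close>. The residue 30 is left to
  temporaries and register 31 (\<open>size_reg\<close>) holds the size parameter.\<close>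

definition loc :: "nat \<Rightarrow> nat \<Rightarrow> nat" where "loc a i = 32 * i + a"

abbreviation tmp :: "nat \<Rightarrow> nat" where "tmp \<equiv> loc 30"
abbreviation size_reg :: nat where "size_reg \<equiv> loc 31 0"

lemma loc_eq_iff [simp]:
  "a < 32 \<Longrightarrow> b < 32 \<Longrightarrow> loc a i = loc b j \<longleftrightarrow> a = b \<and> i = j"
  unfolding loc_def
  by (metis add_left_imp_eq div_mult_self2 div_less add.right_neutral add.commute
      mod_less mod_mult_self2 zero_neq_numeral)

fun wf_exp :: "exp \<Rightarrow> bool" where
  "wf_exp (Arr a e) \<longleftrightarrow> a < 30 \<and> wf_exp e"
| "wf_exp (Plus e f) \<longleftrightarrow> wf_exp e \<and> wf_exp f"
| "wf_exp (Minus e f) \<longleftrightarrow> wf_exp e \<and> wf_exp f"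
| "wf_exp _ \<longleftrightarrow> True"

fun wf_com :: "com \<Rightarrow> bool" where
  "wf_com Skip \<longleftrightarrow> True"
| "wf_com (Assign a e f) \<longleftrightarrow> a < 30 \<and> wf_exp e \<and> wf_exp f"
| "wf_com (c ;; d) \<longleftrightarrow> wf_com c \<and> wf_com d"
| "wf_com (Cond e c d) \<longleftrightarrow> wf_exp e \<and> wf_com c \<and> wf_com d"
| "wf_com (For x a b c) \<longleftrightarrow> x < 30 \<and> wf_com c"
| "wf_com (Get x) \<longleftrightarrow> x < 30"
| "wf_com (Put e) \<longleftrightarrow> wf_exp e"

text \<open>The factor 32 of \<open>loc\<close> is produced by five doublings. Temporaries form a
  stack whose cells from \<open>k\<close> on are free.\<close>

definition addr_code :: "nat \<Rightarrow> nat \<Rightarrow> instr list" where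
  "addr_code a k =
     replicate 5 (Add (tmp k) (tmp k) (tmp k)) @
     [Const (tmp (Suc k)) a, Add (tmp k) (tmp k) (tmp (Suc k))]"

fun exp_code :: "exp \<Rightarrow> nat \<Rightarrow> instr list" where
  "exp_code (Num c) k = [Const (tmp k) c]"
| "exp_code Size k = [Const (tmp k) 0, Add (tmp k) (tmp k) size_reg]"
| "exp_code (Arr a e) k = exp_code e k @ addr_code a k @ [Load (tmp k) (tmp k)]"
| "exp_code (Plus e f) k =
     exp_code e k @ exp_code f (Suc k) @ [Add (tmp k) (tmp k) (tmp (Suc k))]"
| "exp_code (Minus e f) k =
     exp_code e k @ exp_code f (Suc k) @ [Sub (tmp k) (tmp k) (tmp (Suc k))]"

definition for_init :: "nat \<Rightarrow> nat \<Rightarrow> nat \<Rightarrow> instr list" where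
  "for_init a b k =
     Const (tmp k) b # replicate a (Add (tmp k) (tmp k) size_reg) @ [Const (tmp (Suc k)) 0]"

text \<open>Jump targets are absolute, hence the parameter \<open>l\<close>, the address where the
  code will stand. A loop keeps its length in \<open>tmp k\<close> and its counter in
  \<open>tmp (Suc k)\<close>, and the body is compiled at depth \<open>k + 2\<close>. Since
  \<open>x\<close> only receives copies of the counter, a body that assigns to \<open>x\<close>
  cannot change the number of iterations.\<close>

fun com_code :: "com \<Rightarrow> nat \<Rightarrow> nat \<Rightarrow> instr list" where
  "com_code Skip k l = []"
| "com_code (Assign a e f) k l =
     exp_code e k @ addr_code a k @ exp_code f (Suc k) @ [Store (tmp k) (tmp (Suc k))]"
| "com_code (c ;; d) k l = (let C = com_code c k l in C @ com_code d k (l + length C))"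
| "com_code (Cond e c d) k l =
     (let E = exp_code e k;
          C = com_code c k (l + length E + 1);
          m = l + length E + 1 + length C + 1;
          D = com_code d k m
      in E @ JumpZero (tmp k) m # C @ Jump (m + length D) # D)"
| "com_code (For x a b c) k l =
     (let I = for_init a b k;
          m = l + length I;
          C = com_code c (k + 2) (m + 4)
      in I @ Sub (tmp (Suc (Suc k))) (tmp k) (tmp (Suc k))
           # JumpZero (tmp (Suc (Suc k))) (m + 4 + length C + 3)
           # Const (tmp (Suc (Suc k))) 0
           # Add (loc x 0) (tmp (Suc k)) (tmp (Suc (Suc k)))
           # C @ [Const (tmp (Suc (Suc k))) 1,
                  Add (tmp (Suc k)) (tmp (Suc k)) (tmp (Suc (Suc k))),
                  Jump m])"
| "com_code (Get x) k l = [Read (loc x 0)]"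
| "com_code (Put e) k l = exp_code e k @ [Write (tmp k)]"

definition code_at :: "instr list \<Rightarrow> nat \<Rightarrow> instr list \<Rightarrow> bool" where
  "code_at P l C \<longleftrightarrow> (\<exists>A B. P = A @ C @ B \<and> length A = l)"

lemma code_at_append:
  "code_at P l (C @ D) \<longleftrightarrow> code_at P l C \<and> code_at P (l + length C) D"
proof
  assume "code_at P l (C @ D)"
  then show "code_at P l C \<and> code_at P (l + length C) D"
    unfolding code_at_def by (metis append_assoc length_append)
next
  assume "code_at P l C \<and> code_at P (l + length C) D"
  then obtain A B A' B' where *: "P = A @ C @ B" "length A = l"
    "P = A' @ D @ B'" "length A' = l + length C"
    unfolding code_at_def by blast
  then have "(A @ C) @ B = A' @ (D @ B')" by simp
  moreover have "length (A @ C) = length A'" using * by simp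
  ultimately have "A @ C = A'" "B = D @ B'" using append_eq_append_conv by blast+
  then have "P = A @ (C @ D) @ B'" using * by simp
  then show "code_at P l (C @ D)" using * unfolding code_at_def by blast
qed

lemma code_at_Nil: "code_at P l [] \<longleftrightarrow> l \<le> length P"
  unfolding code_at_def
  by (metis append_Nil append_take_drop_id le_add1 length_append length_take min.absorb2)

lemma code_at_Cons:
  "code_at P l (i # C) \<longleftrightarrow> l < length P \<and> P ! l = i \<and> code_at P (Suc l) C"
proof -
  have "code_at P l [i] \<longleftrightarrow> l < length P \<and> P ! l = i"
  proof
    assume "l < length P \<and> P ! l = i"
    then show "code_at P l [i]"
      unfolding code_at_def
      by (metis append_Cons append_Nil id_take_nth_drop length_take min.absorb4)
  qed (auto simp: code_at_def)
  then show ?thesis using code_at_append[of P l "[i]" C] by simp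
qed

fun straight :: "instr \<Rightarrow> bool" where
  "straight (Jump _) = False"
| "straight (JumpZero _ _) = False"
| "straight _ = True"

lemma pc_exec_straight: "straight i \<Longrightarrow> pc (exec_instr i c) = Suc (pc c)"
  by (cases i) (auto simp: set_reg_def split: list.splits)

lemma step_at:
  "code_at P (pc c) (i # C) \<Longrightarrow> step P c = exec_instr i c"
  by (auto simp: code_at_Cons step_def halted_def)

lemma run_straight:
  "code_at P (pc c) C \<Longrightarrow> list_all straight C \<Longrightarrow>
     (step P ^^ length C) c = fold exec_instr C c \<and> pc (fold exec_instr C c) = pc c + length C"
proof (induction C arbitrary: c)
  case (Cons i C)
  have 1: "step P c = exec_instr i c" using Cons.prems(1) by (rule step_at)
  have 2: "pc (exec_instr i c) = Suc (pc c)" using Cons.prems by (simp add: pc_exec_straight)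
  have "code_at P (pc (exec_instr i c)) C" using Cons.prems(1) 2 by (simp add: code_at_Cons)
  from Cons.IH[OF this] Cons.prems(2) 1 2 show ?case
    by (simp add: funpow_swap1 flip: funpow.simps(2))
     (simp add: funpow_swap1)
qed simp

definition represents :: "nat \<Rightarrow> state \<Rightarrow> config \<Rightarrow> bool" where
  "represents n s c \<longleftrightarrow>
     (\<forall>a<30. \<forall>i. reg c (loc a i) = mem s a i) \<and> reg c size_reg = n \<and>
     inp c = unread s \<and> outp c = written s"

text \<open>Temporaries below \<open>k\<close> hold pending values of enclosing expressions and
  loops, so code at depth \<open>k\<close> must leave them intact. The program counter is left
  free.\<close>

definition same_but :: "nat \<Rightarrow> config \<Rightarrow> config \<Rightarrow> bool" where
  "same_but k c c' \<longleftrightarrow>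
     (\<forall>r. (\<forall>j\<ge>k. r \<noteq> tmp j) \<longrightarrow> reg c' r = reg c r) \<and> inp c' = inp c \<and> outp c' = outp c"

lemma same_but_refl: "same_but k c c"
  by (simp add: same_but_def)

lemma same_but_trans: "same_but k c c' \<Longrightarrow> same_but k c' c'' \<Longrightarrow> same_but k c c''"
  by (simp add: same_but_def)

lemma same_but_mono: "same_but k c c' \<Longrightarrow> j \<le> k \<Longrightarrow> same_but j c c'"
  unfolding same_but_def using le_trans by blast

lemma represents_same_but:
  assumes "represents n s c" "same_but k c c'"
  shows "represents n s c'"
  using assms by (auto simp: represents_def same_but_def)

lemma addr_code_correct:
  fixes c :: config and k a :: nat
  defines "c' \<equiv> fold exec_instr (addr_code a k) c"
  shows "same_but k c c'" "reg c' (tmp k) = loc a (reg c (tmp k))"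
proof -
  have "same_but k d (fold exec_instr (replicate m (Add (tmp k) (tmp k) (tmp k))) d) \<and>
      reg (fold exec_instr (replicate m (Add (tmp k) (tmp k) (tmp k))) d) (tmp k) =
        2 ^ m * reg d (tmp k)" for d m
  proof (induction m arbitrary: d)
    case (Suc m)
    from Suc[of "exec_instr (Add (tmp k) (tmp k) (tmp k)) d"] show ?case
      by (auto simp: same_but_def set_reg_def)
  qed (simp add: same_but_refl)
  from this[of c 5] show "same_but k c c'" "reg c' (tmp k) = loc a (reg c (tmp k))"
    by (auto simp: c'_def addr_code_def same_but_def set_reg_def loc_def[of a])
qed

lemma exp_code_correct:
  "represents n s c \<Longrightarrow> wf_exp e \<Longrightarrow>
     same_but k c (fold exec_instr (exp_code e k) c) \<and>
     reg (fold exec_instr (exp_code e k) c) (tmp k) = eval n e s"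
proof (induction e arbitrary: k c)
  case (Num m)
  then show ?case by (auto simp: same_but_def set_reg_def)
next
  case Size
  then show ?case by (auto simp: same_but_def set_reg_def represents_def)
next
  case (Arr a e)
  define c1 where "c1 = fold exec_instr (exp_code e k) c"
  define c2 where "c2 = fold exec_instr (addr_code a k) c1"
  have 1: "same_but k c c1" "reg c1 (tmp k) = eval n e s"
    using Arr.IH[OF Arr.prems(1)] Arr.prems(2) by (simp_all add: c1_def)
  have 2: "same_but k c1 c2" "reg c2 (tmp k) = loc a (eval n e s)"
    using addr_code_correct[where k = k and c = c1 and a = a] 1 by (simp_all add: c2_def)
  have "represents n s c2"
    using represents_same_but Arr.prems(1) 1(1) 2(1) by blast
  then have "reg c2 (loc a (eval n e s)) = mem s a (eval n e s)"
    using Arr.prems(2) by (simp add: represents_def)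
  moreover have "fold exec_instr (exp_code (Arr a e) k) c = exec_instr (Load (tmp k) (tmp k)) c2"
    by (simp add: c1_def c2_def)
  ultimately show ?case
    using 2 same_but_trans[OF 1(1) 2(1)] by (auto simp: same_but_def set_reg_def)
next
  case (Plus e f)
  define c1 where "c1 = fold exec_instr (exp_code e k) c"
  define c2 where "c2 = fold exec_instr (exp_code f (Suc k)) c1"
  have 1: "same_but k c c1" "reg c1 (tmp k) = eval n e s"
    using Plus.IH(1)[OF Plus.prems(1)] Plus.prems(2) by (simp_all add: c1_def)
  have 2: "same_but (Suc k) c1 c2" "reg c2 (tmp (Suc k)) = eval n f s"
    using Plus.IH(2)[OF represents_same_but[OF Plus.prems(1) 1(1)]] Plus.prems(2)
    by (simp_all only: c2_def wf_exp.simps)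
  \<comment> \<open>The left operand survives because the right one is evaluated at depth
    \<open>Suc k\<close>.\<close>
  have "reg c2 (tmp k) = reg c1 (tmp k)" using 2(1) by (simp add: same_but_def)
  moreover have "fold exec_instr (exp_code (Plus e f) k) c
      = exec_instr (Add (tmp k) (tmp k) (tmp (Suc k))) c2"
    by (simp add: c1_def c2_def)
  moreover have "same_but k c c2"
    using same_but_trans[OF 1(1)] same_but_mono[OF 2(1), of k] by simp
  ultimately show ?case
    using 1 2 by (auto simp: same_but_def set_reg_def)
next
  case (Minus e f)
  define c1 where "c1 = fold exec_instr (exp_code e k) c"
  define c2 where "c2 = fold exec_instr (exp_code f (Suc k)) c1"
  have 1: "same_but k c c1" "reg c1 (tmp k) = eval n e s"
    using Minus.IH(1)[OF Minus.prems(1)] Minus.prems(2) by (simp_all add: c1_def)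
  have 2: "same_but (Suc k) c1 c2" "reg c2 (tmp (Suc k)) = eval n f s"
    using Minus.IH(2)[OF represents_same_but[OF Minus.prems(1) 1(1)]] Minus.prems(2)
    by (simp_all only: c2_def wf_exp.simps)
  have "reg c2 (tmp k) = reg c1 (tmp k)" using 2(1) by (simp add: same_but_def)
  moreover have "fold exec_instr (exp_code (Minus e f) k) c
      = exec_instr (Sub (tmp k) (tmp k) (tmp (Suc k))) c2"
    by (simp add: c1_def c2_def)
  moreover have "same_but k c c2"
    using same_but_trans[OF 1(1)] same_but_mono[OF 2(1), of k] by simp
  ultimately show ?case
    using 1 2 by (auto simp: same_but_def set_reg_def)
qed

section \<open>Simulation of the loop language within a step bound\<close>

definition reach_in :: "instr list \<Rightarrow> nat \<Rightarrow> config \<Rightarrow> config \<Rightarrow> bool" where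
  "reach_in P m c c' \<longleftrightarrow> (\<exists>t\<le>m. (step P ^^ t) c = c')"

lemma reach_in_trans: "reach_in P m c c' \<Longrightarrow> reach_in P m' c' c'' \<Longrightarrow> reach_in P (m + m') c c''"
  unfolding reach_in_def
proof (elim exE conjE)
  fix t t' assume "t \<le> m" "(step P ^^ t) c = c'" "t' \<le> m'" "(step P ^^ t') c' = c''"
  then show "\<exists>t\<le>m + m'. (step P ^^ t) c = c''"
    by (intro exI[of _ "t' + t"]) (simp add: funpow_add)
qed

lemma reach_in_mono: "reach_in P m c c' \<Longrightarrow> m \<le> m' \<Longrightarrow> reach_in P m' c c'"
  unfolding reach_in_def using le_trans by blast

lemma reach_in_refl: "reach_in P 0 c c"
  by (simp add: reach_in_def)

lemma reach_in_straight:
  assumes "code_at P (pc c) C" "list_all straight C"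
  shows "reach_in P (length C) c (fold exec_instr C c)"
    "pc (fold exec_instr C c) = pc c + length C"
  using run_straight[OF assms] by (auto simp: reach_in_def)

lemma reach_in_step: "code_at P (pc c) (i # C) \<Longrightarrow> reach_in P 1 c (exec_instr i c)"
  unfolding reach_in_def by (rule exI[of _ 1]) (simp add: step_at)

fun exp_cost :: "exp \<Rightarrow> nat" where
  "exp_cost (Num c) = 1"
| "exp_cost Size = 2"
| "exp_cost (Arr a e) = exp_cost e + 8"
| "exp_cost (Plus e f) = exp_cost e + exp_cost f + 1"
| "exp_cost (Minus e f) = exp_cost e + exp_cost f + 1"

lemma length_addr_code: "length (addr_code a k) = 7"
  by (simp add: addr_code_def)

lemma straight_addr_code: "list_all straight (addr_code a k)"
  by (simp add: addr_code_def numeral_eq_Suc)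

lemma straight_exp_code: "list_all straight (exp_code e k)"
  by (induction e arbitrary: k) (auto simp: straight_addr_code)

lemma length_exp_code: "length (exp_code e k) = exp_cost e"
  by (induction e arbitrary: k) (auto simp: addr_code_def)

lemma exp_code_run:
  assumes "represents n s c" "wf_exp e" "code_at P (pc c) (exp_code e k)"
  obtains c' where "reach_in P (exp_cost e) c c'" "pc c' = pc c + exp_cost e"
    "same_but k c c'" "reg c' (tmp k) = eval n e s" "represents n s c'"
  using that reach_in_straight[OF assms(3) straight_exp_code] exp_code_correct[OF assms(1,2), of k]
    represents_same_but[OF assms(1)]
  by (auto simp: length_exp_code)

text \<open>The branches of a conditional are added, as a polynomial bound for their maximum. For a
  loop, \<open>a + 4\<close> pays for the initialisation and the final test; the 7 consists of two
  instructions for the test, two for setting \<open>x\<close>, and three for advancing the counter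
  and jumping back.\<close>

fun com_cost :: "com \<Rightarrow> nat poly" where
  "com_cost Skip = 0"
| "com_cost (Assign a e f) = [:exp_cost e + exp_cost f + 8:]"
| "com_cost (c ;; d) = com_cost c + com_cost d"
| "com_cost (Cond e c d) = [:exp_cost e + 2:] + com_cost c + com_cost d"
| "com_cost (For x a b c) = [:a + 4:] + [:b, a:] * ([:7:] + com_cost c)"
| "com_cost (Get x) = 1"
| "com_cost (Put e) = [:exp_cost e + 1:]"

lemma for_init_correct:
  fixes c :: config and k a b :: nat
  defines "c' \<equiv> fold exec_instr (for_init a b k) c"
  shows "same_but k c c'" "reg c' (tmp k) = a * reg c size_reg + b" "reg c' (tmp (Suc k)) = 0"
proof -
  have *: "same_but k d (fold exec_instr (replicate a (Add (tmp k) (tmp k) size_reg)) d) \<and>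
      reg (fold exec_instr (replicate a (Add (tmp k) (tmp k) size_reg)) d) (tmp k) =
        a * reg d size_reg + reg d (tmp k)" for d
  proof (induction a arbitrary: d)
    case (Suc a)
    from Suc[of "exec_instr (Add (tmp k) (tmp k) size_reg) d"] show ?case
      by (auto simp: same_but_def set_reg_def)
  qed (simp add: same_but_refl)
  from *[of "exec_instr (Const (tmp k) b) c"]
  show "same_but k c c'" "reg c' (tmp k) = a * reg c size_reg + b" "reg c' (tmp (Suc k)) = 0"
    by (auto simp: c'_def for_init_def same_but_def set_reg_def)
qed

lemma represents_put:
  assumes "represents n s c" "a < 30"
  shows "represents n (put a i v s) (set_reg (loc a i) v c)"
  using assms by (auto simp: represents_def put_def set_reg_def)

lemma represents_pc [simp]: "represents n s (c\<lparr>pc := l\<rparr>) \<longleftrightarrow> represents n s c"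
  by (simp add: represents_def)


text \<open>The step bound depends on \<open>n\<close> and not on the state, which later gives
  polynomial time on every graph. The claim about temporaries below \<open>k\<close> is needed in
  the induction: it is what protects the length and the counter of a loop while its body
  runs.\<close>

lemma com_code_correct:
  "represents n s c \<Longrightarrow> wf_com p \<Longrightarrow> code_at P (pc c) (com_code p k (pc c)) \<Longrightarrow>
     \<exists>c'. reach_in P (poly (com_cost p) n) c c' \<and>
          pc c' = pc c + length (com_code p k (pc c)) \<and>
          represents n (exec n p s) c' \<and> (\<forall>j<k. reg c' (tmp j) = reg c (tmp j))"
proof (induction p arbitrary: k c s)
  case Skip
  then show ?case using reach_in_refl by (auto intro!: exI[of _ c])
next
  case (Assign a e f)
  let ?l = "pc c"
  have code: "code_at P ?l (exp_code e k)"
    "code_at P (?l + exp_cost e) (addr_code a k)"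
    "code_at P (?l + exp_cost e + 7) (exp_code f (Suc k))"
    "code_at P (?l + exp_cost e + 7 + exp_cost f) [Store (tmp k) (tmp (Suc k))]"
    using Assign.prems(3)
    by (simp_all add: code_at_append length_exp_code length_addr_code add.assoc)
  obtain c1 where 1: "reach_in P (exp_cost e) c c1" "pc c1 = ?l + exp_cost e"
    "same_but k c c1" "reg c1 (tmp k) = eval n e s" "represents n s c1"
    using exp_code_run[OF Assign.prems(1) _ code(1)] Assign.prems(2) by auto
  define c2 where "c2 = fold exec_instr (addr_code a k) c1"
  have 2: "reach_in P 7 c1 c2" "pc c2 = ?l + exp_cost e + 7"
    "same_but k c1 c2" "reg c2 (tmp k) = loc a (eval n e s)"
    using reach_in_straight[of P c1 "addr_code a k"] code(2) 1
      addr_code_correct[where c = c1 and a = a and k = k]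
    by (simp_all add: c2_def straight_addr_code length_addr_code)
  have r2: "represents n s c2" using represents_same_but[OF 1(5) 2(3)] .
  obtain c3 where 3: "reach_in P (exp_cost f) c2 c3" "pc c3 = ?l + exp_cost e + 7 + exp_cost f"
    "same_but (Suc k) c2 c3" "reg c3 (tmp (Suc k)) = eval n f s" "represents n s c3"
    using exp_code_run[OF r2 _ code(3)[folded 2(2)]] Assign.prems(2) 2(2) by auto
  have t: "reg c3 (tmp k) = loc a (eval n e s)"
    using 3(3) 2(4) by (simp add: same_but_def)
  define c4 where "c4 = set_reg (loc a (eval n e s)) (eval n f s) c3"
  have "reach_in P 1 c3 c4"
    using reach_in_step[OF code(4)[folded 3(2)]] t 3(4) by (simp add: c4_def)
  from reach_in_trans[OF reach_in_trans[OF reach_in_trans[OF 1(1) 2(1)] 3(1)] this]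
  have r4: "reach_in P (poly (com_cost (Assign a e f)) n) c c4"
    by (rule reach_in_mono) simp
  have "reg c4 (tmp j) = reg c (tmp j)" if "j < k" for j
  proof -
    have "same_but k c c3"
      using 1(3) 2(3) 3(3) by (meson same_but_mono same_but_trans le_SucI order_refl)
    then show ?thesis using that Assign.prems(2) by (simp add: c4_def set_reg_def same_but_def)
  qed
  moreover have "represents n (exec n (Assign a e f) s) c4"
    using represents_put[OF 3(5)] Assign.prems(2) by (simp add: c4_def)
  moreover have "pc c4 = pc c + length (com_code (Assign a e f) k (pc c))"
    using 3(2) by (simp add: c4_def set_reg_def length_exp_code length_addr_code)
  ultimately show ?case using r4 by blast
next
  case (Seq p q)
  let ?l = "pc c" and ?C = "com_code p k (pc c)"
  have code: "code_at P ?l ?C" "code_at P (?l + length ?C) (com_code q k (?l + length ?C))"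
    using Seq.prems(3) by (simp_all add: code_at_append Let_def)
  obtain c1 where 1: "reach_in P (poly (com_cost p) n) c c1" "pc c1 = ?l + length ?C"
    "represents n (exec n p s) c1" "\<forall>j<k. reg c1 (tmp j) = reg c (tmp j)"
    using Seq.IH(1)[OF Seq.prems(1) _ code(1)] Seq.prems(2) by auto
  obtain c2 where 2: "reach_in P (poly (com_cost q) n) c1 c2"
    "pc c2 = ?l + length ?C + length (com_code q k (?l + length ?C))"
    "represents n (exec n q (exec n p s)) c2" "\<forall>j<k. reg c2 (tmp j) = reg c1 (tmp j)"
    using Seq.IH(2)[OF 1(3) _ code(2)[folded 1(2)]] Seq.prems(2) 1(2) by auto
  have "reach_in P (poly (com_cost (p ;; q)) n) c c2"
    using reach_in_trans[OF 1(1) 2(1)] by simp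
  then show ?case using 1(4) 2 by (intro exI[of _ c2]) (simp add: Let_def)
next
  case (Cond e p q)
  let ?l = "pc c"
  let ?m = "?l + exp_cost e + 1"
  let ?C = "com_code p k ?m"
  let ?m' = "?m + length ?C + 1"
  let ?D = "com_code q k ?m'"
  have code: "code_at P ?l (exp_code e k)"
    "code_at P (?l + exp_cost e) [JumpZero (tmp k) ?m']"
    "code_at P ?m ?C" "code_at P (?m + length ?C) [Jump (?m' + length ?D)]"
    "code_at P ?m' ?D"
    using Cond.prems(3)
    by (simp_all add: code_at_append code_at_Cons code_at_Nil Let_def length_exp_code)
  have len: "?l + length (com_code (Cond e p q) k ?l) = ?m' + length ?D"
    by (simp add: Let_def length_exp_code)
  obtain c1 where 1: "reach_in P (exp_cost e) c c1" "pc c1 = ?l + exp_cost e"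
    "same_but k c c1" "reg c1 (tmp k) = eval n e s" "represents n s c1"
    using exp_code_run[OF Cond.prems(1) _ code(1)] Cond.prems(2) by auto
  have keep: "\<forall>j<k. reg c1 (tmp j) = reg c (tmp j)" using 1(3) by (simp add: same_but_def)
  define c2 where "c2 = c1\<lparr>pc := (if eval n e s = 0 then ?m' else ?m)\<rparr>"
  have 2: "reach_in P 1 c1 c2"
    using reach_in_step[OF code(2)[folded 1(2)]] 1(2,4)
    by (cases "eval n e s = 0") (simp_all add: c2_def)
  have r2: "represents n s c2" using 1(5) by (simp add: c2_def)
  show ?case
  proof (cases "eval n e s = 0")
    case True
    have "code_at P (pc c2) (com_code q k (pc c2))" using code(5) True by (simp add: c2_def)
    then obtain c3 where 3: "reach_in P (poly (com_cost q) n) c2 c3" "pc c3 = ?m' + length ?D"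
      "represents n (exec n q s) c3" "\<forall>j<k. reg c3 (tmp j) = reg c2 (tmp j)"
      using Cond.IH(2)[OF r2] Cond.prems(2) True by (auto simp: c2_def)
    from reach_in_trans[OF reach_in_trans[OF 1(1) 2] 3(1)]
    have "reach_in P (poly (com_cost (Cond e p q)) n) c c3"
      by (rule reach_in_mono) simp
    then show ?thesis unfolding len
      using 3 True keep by (intro exI[of _ c3]) (simp add: c2_def)
  next
    case False
    have "code_at P (pc c2) (com_code p k (pc c2))" using code(3) False by (simp add: c2_def)
    then obtain c3 where 3: "reach_in P (poly (com_cost p) n) c2 c3" "pc c3 = ?m + length ?C"
      "represents n (exec n p s) c3" "\<forall>j<k. reg c3 (tmp j) = reg c2 (tmp j)"
      using Cond.IH(1)[OF r2] Cond.prems(2) False by (auto simp: c2_def)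
    define c4 where "c4 = c3\<lparr>pc := ?m' + length ?D\<rparr>"
    have "reach_in P 1 c3 c4"
      using reach_in_step[of P c3 "Jump (?m' + length ?D)" "[]"] code(4) 3(2)
      by (simp add: c4_def)
    from reach_in_trans[OF reach_in_trans[OF reach_in_trans[OF 1(1) 2] 3(1)] this]
    have "reach_in P (poly (com_cost (Cond e p q)) n) c c4"
      by (rule reach_in_mono) simp
    then show ?thesis unfolding len
      using 3 False keep by (intro exI[of _ c4]) (simp add: c2_def c4_def)
  qed
next
  case (For x a b p)
  let ?l = "pc c"
  let ?m = "?l + a + 2"
  let ?C = "com_code p (k + 2) (?m + 4)"
  let ?h = "[Sub (tmp (Suc (Suc k))) (tmp k) (tmp (Suc k)),
             JumpZero (tmp (Suc (Suc k))) (?m + 4 + length ?C + 3)]"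
  let ?i = "[Const (tmp (Suc (Suc k))) 0, Add (loc x 0) (tmp (Suc k)) (tmp (Suc (Suc k)))]"
  let ?t = "[Const (tmp (Suc (Suc k))) 1, Add (tmp (Suc k)) (tmp (Suc k)) (tmp (Suc (Suc k))),
             Jump ?m]"
  have x: "x < 30" "wf_com p" using For.prems(2) by auto
  have len: "length (for_init a b k) = a + 2" by (simp add: for_init_def)
  have code: "code_at P ?l (for_init a b k)" "code_at P ?m ?h" "code_at P (?m + 2) ?i"
    "code_at P (?m + 4) ?C" "code_at P (?m + 4 + length ?C) ?t"
    using For.prems(3)
    by (simp_all add: code_at_append code_at_Cons code_at_Nil Let_def len eval_nat_numeral)
  define N where "N = a * n + b"
  define T where "T = poly (com_cost p) n"
  let ?f = "\<lambda>i s. exec n p (put x 0 i s)"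
  \<comment> \<open>The invariant is taken at \<open>?m\<close>, the address of the loop test, after
    \<open>i\<close> complete iterations.\<close>
  let ?inv = "\<lambda>i c'. pc c' = ?m \<and> reg c' (tmp k) = N \<and> reg c' (tmp (Suc k)) = i \<and>
    represents n (fold ?f [0..<i] s) c' \<and> (\<forall>j<k. reg c' (tmp j) = reg c (tmp j))"
  have loop: "i \<le> N \<Longrightarrow> \<exists>c'. reach_in P (a + 2 + i * (T + 7)) c c' \<and> ?inv i c'" for i
  proof (induction i)
    case 0
    define c1 where "c1 = fold exec_instr (for_init a b k) c"
    have "list_all straight (for_init a b k)" by (simp add: for_init_def list_all_iff)
    from reach_in_straight[OF code(1) this]
    have "reach_in P (a + 2) c c1" "pc c1 = ?m" by (simp_all add: c1_def len)
    moreover have "same_but k c c1" "reg c1 (tmp k) = N" "reg c1 (tmp (Suc k)) = 0"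
      using for_init_correct[where a = a and b = b and k = k and c = c] For.prems(1)
      by (simp_all add: c1_def N_def represents_def)
    moreover have "represents n s c1" using represents_same_but For.prems(1) calculation by blast
    ultimately show ?case by (intro exI[of _ c1]) (simp add: same_but_def)
  next
    case (Suc i)
    then obtain c1 where 1: "reach_in P (a + 2 + i * (T + 7)) c c1" "pc c1 = ?m"
      "reg c1 (tmp k) = N" "reg c1 (tmp (Suc k)) = i" "represents n (fold ?f [0..<i] s) c1"
      "\<forall>j<k. reg c1 (tmp j) = reg c (tmp j)" by auto
    define c2 where "c2 = (set_reg (tmp (Suc (Suc k))) (N - i) c1)\<lparr>pc := ?m + 2\<rparr>"
    have 2: "reach_in P 2 c1 c2"
    proof -
      have a: "reach_in P 1 c1 (set_reg (tmp (Suc (Suc k))) (N - i) c1)"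
        using reach_in_step[of P c1] code(2) 1(2,3,4) by (force simp: set_reg_def)
      have "code_at P (pc (set_reg (tmp (Suc (Suc k))) (N - i) c1))
          [JumpZero (tmp (Suc (Suc k))) (?m + 4 + length ?C + 3)]"
        using code(2) 1(2) by (simp add: code_at_Cons code_at_Nil set_reg_def)
      from reach_in_step[OF this] have "reach_in P 1 (set_reg (tmp (Suc (Suc k))) (N - i) c1) c2"
        using Suc.prems 1(2) by (simp add: c2_def set_reg_def)
      from reach_in_trans[OF a this] show ?thesis by (simp add: numeral_2_eq_2)
    qed
    define c3 where "c3 = fold exec_instr ?i c2"
    have 3: "reach_in P 2 c2 c3" "pc c3 = ?m + 4"
      using reach_in_straight[of P c2 ?i] code(3)
      by (simp_all add: c3_def c2_def eval_nat_numeral)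
    have r3: "represents n (put x 0 i (fold ?f [0..<i] s)) c3"
    proof -
      let ?c = "set_reg (loc x 0) i c1"
      have "reg c3 (loc a j) = reg ?c (loc a j)" if "a < 30" for a j
        using that x(1) 1(4) by (simp add: c3_def c2_def set_reg_def)
      moreover have "reg c3 size_reg = reg ?c size_reg" "inp c3 = inp ?c" "outp c3 = outp ?c"
        using x(1) by (simp_all add: c3_def c2_def set_reg_def)
      ultimately show ?thesis
        using represents_put[OF 1(5) x(1), of 0 i] by (simp add: represents_def)
    qed
    have k3: "\<forall>j<k + 2. reg c3 (tmp j) = reg c1 (tmp j)"
      using x(1) by (auto simp: c3_def c2_def set_reg_def)
    obtain c4 where 4: "reach_in P T c3 c4" "pc c4 = ?m + 4 + length ?C"
      "represents n (fold ?f [0..<Suc i] s) c4" "\<forall>j<k + 2. reg c4 (tmp j) = reg c3 (tmp j)"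
      using For.IH[OF r3 x(2), of "k + 2"] code(4) 3(2) by (auto simp: T_def)
    define c5 where "c5 = fold exec_instr (take 2 ?t) c4"
    have 5: "reach_in P 2 c4 c5" "pc c5 = ?m + 4 + length ?C + 2"
      using reach_in_straight[of P c4 "take 2 ?t"] code(5) 4(2)
      by (simp_all add: c5_def code_at_Cons code_at_Nil eval_nat_numeral)
    define c6 where "c6 = c5\<lparr>pc := ?m\<rparr>"
    have "code_at P (pc c5) [Jump ?m]"
      using code(5) 5(2) by (simp add: code_at_Cons code_at_Nil)
    from reach_in_step[OF this] have 6: "reach_in P 1 c5 c6" by (simp add: c6_def)
    have r6: "represents n (fold ?f [0..<Suc i] s) c6"
      using 4(3) by (simp add: c6_def c5_def represents_def set_reg_def)
    have k6: "\<forall>j<k. reg c6 (tmp j) = reg c (tmp j)" "reg c6 (tmp k) = N"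
      "reg c6 (tmp (Suc k)) = Suc i"
      using 4(4) k3 1(3,4,6) by (simp_all add: c6_def c5_def set_reg_def)
    from reach_in_trans[OF reach_in_trans[OF reach_in_trans[OF reach_in_trans[OF
      reach_in_trans[OF 1(1) 2] 3(1)] 4(1)] 5(1)] 6]
    have "reach_in P (a + 2 + Suc i * (T + 7)) c c6"
      by (rule reach_in_mono) simp
    then show ?case using r6 k6 by (intro exI[of _ c6]) (simp add: c6_def)
  qed
  obtain c1 where 1: "reach_in P (a + 2 + N * (T + 7)) c c1" "pc c1 = ?m"
    "reg c1 (tmp k) = N" "reg c1 (tmp (Suc k)) = N" "represents n (fold ?f [0..<N] s) c1"
    "\<forall>j<k. reg c1 (tmp j) = reg c (tmp j)" using loop[of N] by auto
  \<comment> \<open>The counter has reached the length, so their truncated difference is 0 and the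
    test leaves the loop.\<close>
  define c2 where "c2 = set_reg (tmp (Suc (Suc k))) 0 c1"
  define c3 where "c3 = c2\<lparr>pc := ?m + 4 + length ?C + 3\<rparr>"
  have 2: "reach_in P 1 c1 c2"
    using reach_in_step[of P c1] code(2) 1(2,3,4) by (force simp: c2_def set_reg_def)
  have "code_at P (pc c2) [JumpZero (tmp (Suc (Suc k))) (?m + 4 + length ?C + 3)]"
    using code(2) 1(2) by (simp add: code_at_Cons code_at_Nil c2_def set_reg_def)
  from reach_in_step[OF this] have 3: "reach_in P 1 c2 c3"
    by (simp add: c3_def c2_def set_reg_def)
  from reach_in_trans[OF reach_in_trans[OF 1(1) 2] 3]
  have "reach_in P (poly (com_cost (For x a b p)) n) c c3"
    by (rule reach_in_mono) (simp add: N_def T_def algebra_simps)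
  moreover have "represents n (exec n (For x a b p) s) c3"
    using 1(5) by (simp add: c3_def c2_def N_def represents_def set_reg_def)
  moreover have "pc c3 = pc c + length (com_code (For x a b p) k (pc c))"
    by (simp add: c3_def Let_def len)
  moreover have "\<forall>j<k. reg c3 (tmp j) = reg c (tmp j)"
    using 1(6) by (simp add: c3_def c2_def set_reg_def)
  ultimately show ?case by blast
next
  case (Get x)
  define c' where "c' = exec_instr (Read (loc x 0)) c"
  have "reach_in P 1 c c'"
    using reach_in_step[of P c "Read (loc x 0)"] Get.prems(3) by (simp add: c'_def)
  moreover have "pc c' = Suc (pc c)"
    by (simp add: c'_def set_reg_def split: list.split)
  moreover have "represents n (exec n (Get x) s) c'" "\<forall>j. reg c' (tmp j) = reg c (tmp j)"
    using Get.prems(1,2) represents_put[OF Get.prems(1), of x 0]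
    by (auto simp: c'_def represents_def set_reg_def put_def split: list.split)
  ultimately show ?case by (intro exI[of _ c']) simp
next
  case (Put e)
  have code: "code_at P (pc c) (exp_code e k)" "code_at P (pc c + exp_cost e) [Write (tmp k)]"
    using Put.prems(3) by (simp_all add: code_at_append length_exp_code)
  obtain c1 where 1: "reach_in P (exp_cost e) c c1" "pc c1 = pc c + exp_cost e"
    "same_but k c c1" "reg c1 (tmp k) = eval n e s" "represents n s c1"
    using exp_code_run[OF Put.prems(1) _ code(1)] Put.prems(2) by auto
  define c2 where "c2 = exec_instr (Write (tmp k)) c1"
  have "reach_in P 1 c1 c2" using reach_in_step[OF code(2)[folded 1(2)]] by (simp add: c2_def)
  from reach_in_trans[OF 1(1) this] show ?case
    using 1 by (intro exI[of _ c2])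
      (auto simp: c2_def represents_def same_but_def length_exp_code)
qed

definition program :: "com \<Rightarrow> instr list" where
  "program p = Read size_reg # com_code p 0 1"

definition start :: "nat list \<Rightarrow> state" where
  "start xs = \<lparr>mem = (\<lambda>_ _. 0), unread = xs, written = []\<rparr>"

text \<open>The first input entry becomes the size parameter before the loop program starts on the
  remaining tape. Nothing is assumed about \<open>xs\<close>, so the time bound covers all
  inputs.\<close>

lemma program_correct:
  assumes "wf_com p"
  shows "\<exists>t\<le>1 + poly (com_cost p) n. halted (program p) (run (program p) (n # xs) t) \<and>
    outp (run (program p) (n # xs) t) = written (exec n p (start xs))"
proof -
  let ?P = "program p"
  define c where "c = exec_instr (Read size_reg) (init_config (n # xs))"
  have "code_at ?P 0 (Read size_reg # com_code p 0 1)"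
    unfolding code_at_def program_def by auto
  then have code: "code_at ?P (pc (init_config (n # xs))) [Read size_reg]"
    "code_at ?P (pc c) (com_code p 0 (pc c))" "pc c = 1"
    by (auto simp: c_def init_config_def set_reg_def code_at_Cons code_at_Nil Suc_le_eq)
  have "represents n (start xs) c"
    by (auto simp: c_def init_config_def set_reg_def represents_def start_def)
  from com_code_correct[OF this assms code(2)] obtain c' where
    c': "reach_in ?P (poly (com_cost p) n) c c'" "pc c' = length ?P"
    "represents n (exec n p (start xs)) c'"
    using code(3) by (auto simp: program_def)
  from reach_in_trans[OF reach_in_step[OF code(1), folded c_def] c'(1)]
  obtain t where "t \<le> 1 + poly (com_cost p) n" "run ?P (n # xs) t = c'"
    by (auto simp: reach_in_def run_def)
  then show ?thesis
    using c'(2,3) by (auto simp: halted_def represents_def)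
qed

text \<open>Passes from a cost bound in the number of vertices to one in the length of the
  input.\<close>

lemma poly_nat_mono: "m \<le> n \<Longrightarrow> poly (p :: nat poly) m \<le> poly p n"
  by (induction p) (auto intro: add_mono mult_mono)

section \<open>Degree sums under acquaintance time one\<close>

locale swap_graph =
  fixes V :: "'a set" and adj :: "'a \<Rightarrow> 'a \<Rightarrow> bool" and \<sigma> :: "'a \<Rightarrow> 'a"
  assumes fin: "finite V"
    and sym: "adj a b \<Longrightarrow> adj b a"
    and bij: "bij_betw \<sigma> V V"
    and swap: "a \<in> V \<Longrightarrow> b \<in> V \<Longrightarrow> a \<noteq> b \<Longrightarrow> adj a b \<or> adj (\<sigma> a) (\<sigma> b)"
begin

definition deg :: "'a \<Rightarrow> nat" where "deg a = card {w \<in> V - {a}. adj a w}"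

text \<open>Every \<open>w\<close> other than \<open>u\<close> is a neighbour of \<open>u\<close>,
  or else \<open>\<sigma> w\<close> is a neighbour of \<open>\<sigma> u\<close>. As
  \<open>\<sigma>\<close> is injective, the two degrees together account for all
  \<open>card V - 1\<close> choices of \<open>w\<close>.\<close>

lemma deg_sum_swap:
  assumes "u \<in> V"
  shows "card V - 1 \<le> deg u + deg (\<sigma> u)"
proof -
  let ?A = "{w \<in> V - {u}. adj u w}" and ?B = "{w \<in> V - {u}. adj (\<sigma> u) (\<sigma> w)}"
  have inj: "inj_on \<sigma> V" and im: "\<sigma> ` V = V" using bij by (auto simp: bij_betw_def)
  have "\<sigma> ` ?B \<subseteq> {w \<in> V - {\<sigma> u}. adj (\<sigma> u) w}"
    using im inj assms by (auto dest: inj_onD)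
  then have "card (\<sigma> ` ?B) \<le> deg (\<sigma> u)"
    unfolding deg_def using fin by (intro card_mono) auto
  moreover have "card (\<sigma> ` ?B) = card ?B"
    by (rule card_image) (auto intro: inj_on_subset[OF inj])
  moreover have "card (V - {u}) \<le> card (?A \<union> ?B)"
    using fin swap[OF assms] by (intro card_mono) auto
  moreover have "card (?A \<union> ?B) \<le> card ?A + card ?B" by (rule card_Un_le)
  ultimately show ?thesis using assms fin by (simp add: deg_def)
qed

lemma many_large:
  assumes "A \<subseteq> V" "\<And>w. w \<in> A \<Longrightarrow> deg w \<le> h"
  obtains B where "B \<subseteq> V" "card B = card A" "\<And>w. w \<in> B \<Longrightarrow> card V - 1 - h \<le> deg w"
proof (rule that[of "\<sigma> ` A"])
  show "\<sigma> ` A \<subseteq> V" using assms(1) bij by (auto simp: bij_betw_def)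
  show "card (\<sigma> ` A) = card A"
    using assms(1) bij card_image inj_on_subset unfolding bij_betw_def by metis
  show "card V - 1 - h \<le> deg w" if "w \<in> \<sigma> ` A" for w
    using that deg_sum_swap assms by fastforce
qed

text \<open>An edge outweighs every degree sum. The pairs heavier than \<open>c\<close> play the role of the edges
  present in the Bondy-Chvatal closure before a nonadjacent pair of degree sum \<open>c\<close> is added; here
  the degrees are those of the given graph, and no closure is computed.\<close>

definition weight :: "'a \<Rightarrow> 'a \<Rightarrow> nat" where
  "weight u v = (if adj u v then 2 * card V + 2 else deg u + deg v)"

definition heavy :: "nat \<Rightarrow> 'a \<Rightarrow> 'a set" where
  "heavy c u = {w \<in> V - {u}. c < weight u w}"

lemma weight_sym: "weight u v = weight v u"
  using sym by (auto simp: weight_def)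

lemma deg_less: "u \<in> V \<Longrightarrow> deg u < card V"
  unfolding deg_def using fin by (intro psubset_card_mono) auto

text \<open>Neighbours are heavy partners, because an edge weighs
  \<open>2 * card V + 2\<close>.\<close>

lemma deg_le_heavy:
  assumes "c \<le> 2 * card V"
  shows "deg u \<le> card (heavy c u)"
  unfolding deg_def heavy_def using fin assms by (intro card_mono) (auto simp: weight_def)

text \<open>Let \<open>h \<le> g\<close> be the two counts and suppose
  \<open>h + g < card V - 1\<close>. Too many vertices then fail to be heavy for \<open>v\<close>;
  all of these have degree at most \<open>deg u\<close>, so \<open>\<sigma>\<close> yields equally
  many vertices of large degree. They cannot all be heavy for \<open>u\<close>, yet one that is not
  has degree at most \<open>deg v\<close>, which is too small.\<close>

lemma heavy_sum_aux:
  assumes uv: "u \<in> V" "v \<in> V" "weight u v \<le> c" "c \<le> 2 * card V" "u \<noteq> v" 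
    and c: "c = deg u + deg v"
    and le: "card (heavy c u) \<le> card (heavy c v)"
  shows "card V - 1 \<le> card (heavy c u) + card (heavy c v)"
proof (rule ccontr)
  let ?h = "card (heavy c u)" and ?g = "card (heavy c v)"
  assume "\<not> ?thesis"
  then have lt: "?h + ?g < card V - 1" by simp
  \<comment> \<open>For \<open>w\<close> in this set
    \<open>deg v + deg w \<le> c = deg u + deg v\<close>, and there are
    \<open>card V - 1 - ?g > ?h\<close> such \<open>w\<close>, possibly including
    \<open>u\<close>.\<close>
  let ?A = "V - {v} - heavy c v"
  have "card ?A = card (V - {v}) - ?g"
    using fin by (intro card_Diff_subset) (auto simp: heavy_def)
  then have A: "?h < card ?A" using lt uv(2) fin by simp
  have "deg w \<le> ?h" if "w \<in> ?A" for w
  proof -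
    have "deg w \<le> deg u"
      using that c deg_less[of v] uv unfolding heavy_def weight_def
      by (auto split: if_splits)
    then show ?thesis using deg_le_heavy[OF uv(4), of u] by simp
  qed
  then obtain B where B: "B \<subseteq> V" "card B = card ?A"
    "\<And>w. w \<in> B \<Longrightarrow> card V - 1 - ?h \<le> deg w"
    using many_large[of ?A ?h] by (auto simp del: Diff_iff)
  have "\<not> B \<subseteq> heavy c u"
    using card_mono[of "heavy c u" B] A B(2) fin by (auto simp: heavy_def)
  then obtain w where w: "w \<in> B" "w \<notin> heavy c u" by blast
  \<comment> \<open>Otherwise \<open>card V - 1 - ?h \<le> deg u \<le> ?h\<close>, against
    \<open>2 * ?h \<le> ?h + ?g < card V - 1\<close>; this is where the order of the two counts
    matters.\<close>
  have "w \<noteq> u"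
    using B(3)[OF w(1)] deg_le_heavy[OF uv(4), of u] lt le by auto
  then have "deg w \<le> deg v"
    using w B(1) c uv(4) unfolding heavy_def weight_def
    by (auto split: if_splits)
  then show False
    using B(3)[OF w(1)] deg_le_heavy[OF uv(4), of v] lt by simp
qed

text \<open>The bound on \<open>c\<close> excludes edges, so the weight is a degree sum; the
  auxiliary lemma then applies with the ends ordered by their counts.\<close>

lemma heavy_sum:
  assumes uv: "u \<in> V" "v \<in> V" "u \<noteq> v" and c: "c = weight u v" "c \<le> 2 * card V"
  shows "card V - 1 \<le> card (heavy c u) + card (heavy c v)"
proof -
  have "c = deg u + deg v" using c by (auto simp: weight_def split: if_splits)
  with heavy_sum_aux[of u v c] heavy_sum_aux[of v u c] show ?thesis
    using uv c weight_sym[of u v] by (cases "card (heavy c u) \<le> card (heavy c v)") auto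
qed

end

section \<open>Improving a tour by reversing segments\<close>

text \<open>The 2-opt move of tour heuristics. Only the consecutive pairs at positions
  \<open>i\<close> and \<open>j\<close> are exchanged; those inside the segment are merely traversed
  backwards.\<close>

definition reverse_segment :: "nat \<Rightarrow> nat \<Rightarrow> (nat \<Rightarrow> 'a) \<Rightarrow> nat \<Rightarrow> 'a" where
  "reverse_segment i j p k = (if i < k \<and> k \<le> j then p (i + 1 + j - k) else p k)"

text \<open>Turns counts of vertices into counts of tour positions.\<close>

lemma card_Collect_bij:
  fixes q :: "nat \<Rightarrow> nat"
  assumes "inj_on q {..<N}" "q ` {..<N} \<subseteq> {..<N}"
  shows "card {k. k < N \<and> Q (q k)} = card {w. w < N \<and> Q w}"
proof -
  have "q ` {..<N} = {..<N}" using endo_inj_surj assms by blast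
  then have "{..<N} \<inter> {w. Q w} = q ` ({..<N} \<inter> {k. Q (q k)})" by auto
  then have "q ` {k. k < N \<and> Q (q k)} = {w. w < N \<and> Q w}"
    by (simp add: Int_def)
  moreover have "inj_on q {k. k < N \<and> Q (q k)}"
    by (rule inj_on_subset[OF assms(1)]) auto
  ultimately show ?thesis using card_image by metis
qed

text \<open>\<open>N\<close> includes the universal vertex and \<open>M\<close> will be the weight
  of an edge. \<open>W_heavy\<close> is an Ore condition in which each pair is judged by its own
  weight.\<close>

locale two_opt =
  fixes N M :: nat and W :: "nat \<Rightarrow> nat \<Rightarrow> nat"
  assumes N: "2 \<le> N"
    and W_sym: "W u v = W v u"
    and W_heavy: "u < N \<Longrightarrow> v < N \<Longrightarrow> u \<noteq> v \<Longrightarrow> W u v < M \<Longrightarrow>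
      N \<le> card {w. w < N \<and> w \<noteq> u \<and> W u v < W u w} + card {w. w < N \<and> w \<noteq> v \<and> W u v < W v w}"
begin

text \<open>The start is repeated at position \<open>N\<close>, so that the closing pair is also of
  the form \<open>p k\<close>, \<open>p (Suc k)\<close> with \<open>k < N\<close> and no index is
  reduced modulo \<open>N\<close>.\<close>

definition tour :: "(nat \<Rightarrow> nat) \<Rightarrow> bool" where
  "tour p \<longleftrightarrow> p 0 = p N \<and> inj_on p {1..N} \<and> p ` {..N} \<subseteq> {..<N}"

definition light :: "nat \<Rightarrow> (nat \<Rightarrow> nat) \<Rightarrow> nat set" where
  "light c p = {k. k < N \<and> W (p k) (p (Suc k)) \<le> c}"

text \<open>The partner position of a light pair may lie on either side of it, hence the
  disjunction: one light pair among the two removed ones is enough.\<close>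

definition improving :: "nat \<Rightarrow> (nat \<Rightarrow> nat) \<Rightarrow> nat \<Rightarrow> nat \<Rightarrow> bool" where
  "improving c p i j \<longleftrightarrow> i < j \<and> (W (p i) (p (Suc i)) \<le> c \<or> W (p j) (p (Suc j)) \<le> c) \<and>
     c < W (p i) (p j) \<and> c < W (p (Suc i)) (p (Suc j))"

definition move :: "nat \<Rightarrow> nat \<Rightarrow> nat \<Rightarrow> (nat \<Rightarrow> nat) \<Rightarrow> nat \<Rightarrow> nat" where
  "move c i j p = (if improving c p i j then reverse_segment i j p else p)"

definition pass :: "nat \<Rightarrow> (nat \<Rightarrow> nat) \<Rightarrow> nat \<Rightarrow> nat" where
  "pass c = fold (\<lambda>i. fold (move c i) [0..<N]) [0..<N]"

text \<open>\<open>N\<close> passes suffice for a level: there are at most \<open>N\<close> light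
  pairs, and each pass removes at least one as long as any is left.\<close>

definition optimize :: "(nat \<Rightarrow> nat) \<Rightarrow> nat \<Rightarrow> nat" where
  "optimize = fold (\<lambda>c. fold (\<lambda>_. pass c) [0..<N]) [0..<M]"

lemma finite_light: "finite (light c p)"
  by (simp add: light_def)

lemma tour_less: "tour p \<Longrightarrow> k \<le> N \<Longrightarrow> p k < N"
  by (auto simp: tour_def)

lemma tour_inj:
  assumes "tour p"
  shows "inj_on p {..<N}" "inj_on (\<lambda>k. p (Suc k)) {..<N}"
proof -
  have *: "p a = p b \<Longrightarrow> a = b" if "a \<in> {1..N}" "b \<in> {1..N}" for a b
    using assms that by (auto simp: tour_def dest: inj_onD)
  show "inj_on (\<lambda>k. p (Suc k)) {..<N}" using *[of "Suc _" "Suc _"] by (intro inj_onI) auto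
  have 0: "p 0 = p N" using assms by (simp add: tour_def)
  show "inj_on p {..<N}"
  proof (rule inj_onI)
    fix a b assume "a \<in> {..<N}" "b \<in> {..<N}" "p a = p b"
    then show "a = b"
      using 0 *[of a b] *[of N b] *[of a N] by (cases "a = 0"; cases "b = 0") auto
  qed
qed

text \<open>Ore's crossing argument: \<open>u\<close> has heavy partners at the positions in
  \<open>?S\<close>, \<open>v\<close> has heavy partners directly after the positions in
  \<open>?T\<close>, and a common position \<open>j\<close> makes both new pairs heavy.\<close>

lemma exists_improving:
  assumes p: "tour p" and ge: "\<And>k. k < N \<Longrightarrow> c \<le> W (p k) (p (Suc k))"
    and c: "c < M" and i: "i \<in> light c p"
  shows "\<exists>i<N. \<exists>j<N. improving c p i j"
proof -
  let ?u = "p i" and ?v = "p (Suc i)"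
  have iN: "i < N" and W: "W ?u ?v = c" using i ge[of i] by (auto simp: light_def)
  have uv: "?u < N" "?v < N" using tour_less[OF p] iN by auto
  have neq: "?u \<noteq> ?v"
  proof (cases "Suc i = N")
    case True
    then have "?v = p 0" using p by (simp add: tour_def)
    then show ?thesis using inj_onD[OF tour_inj(1)[OF p], of i 0] True N by auto
  next
    case False
    then show ?thesis using inj_onD[OF tour_inj(1)[OF p], of i "Suc i"] iN by auto
  qed
  let ?S = "{j. j < N \<and> p j \<noteq> ?u \<and> c < W ?u (p j)}"
  let ?T = "{j. j < N \<and> p (Suc j) \<noteq> ?v \<and> c < W ?v (p (Suc j))}"
  have "card ?S = card {w. w < N \<and> w \<noteq> ?u \<and> c < W ?u w}"
    using card_Collect_bij[OF tour_inj(1)[OF p], of "\<lambda>w. w \<noteq> ?u \<and> c < W ?u w"]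
      tour_less[OF p] by fastforce
  moreover have "card ?T = card {w. w < N \<and> w \<noteq> ?v \<and> c < W ?v w}"
    using card_Collect_bij[OF tour_inj(2)[OF p], of "\<lambda>w. w \<noteq> ?v \<and> c < W ?v w"]
      tour_less[OF p] by fastforce
  ultimately have "N \<le> card ?S + card ?T"
    using W_heavy[OF uv neq] W c by simp
  \<comment> \<open>Neither set contains \<open>i\<close>, since \<open>p i\<close> is
    \<open>?u\<close> and \<open>p (Suc i)\<close> is \<open>?v\<close>. So at least
    \<open>N\<close> memberships fall on \<open>N - 1\<close> positions.\<close>
  moreover have "card (?S \<union> ?T) \<le> card ({..<N} - {i})"
    by (rule card_mono) auto
  moreover have "card ?S + card ?T = card (?S \<union> ?T) + card (?S \<inter> ?T)"
    by (rule card_Un_Int) auto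
  ultimately have "card (?S \<inter> ?T) \<noteq> 0" using iN by auto
  then have "?S \<inter> ?T \<noteq> {}" by (intro notI) (simp only: card.empty)
  then obtain j where j: "j \<in> ?S \<inter> ?T" by blast
  then have "i \<noteq> j" by auto
  then consider "i < j" | "j < i" by linarith
  then show ?thesis
  proof cases
    case 1
    then have "improving c p i j" using j W by (auto simp: improving_def)
    then show ?thesis using j iN by auto
  next
    case 2
    then have "improving c p j i" using j W W_sym by (auto simp: improving_def)
    then show ?thesis using j iN by auto
  qed
qed

lemma tour_reverse_segment:
  assumes p: "tour p" and "i < j" "j < N"
  shows "tour (reverse_segment i j p)"
proof -
  let ?r = "\<lambda>k. if i < k \<and> k \<le> j then i + 1 + j - k else k"
  have eq: "reverse_segment i j p = p \<circ> ?r" by (auto simp: reverse_segment_def)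
  have "inj_on ?r {1..N}" "?r ` {1..N} \<subseteq> {1..N}" using assms(2,3)
    by (auto simp: inj_on_def split: if_splits)
  moreover from this have "inj_on p (?r ` {1..N})"
    using p inj_on_subset unfolding tour_def by blast
  ultimately have "inj_on (p \<circ> ?r) {1..N}" by (intro comp_inj_on)
  moreover have "(p \<circ> ?r) k < N" if "k \<le> N" for k
    using tour_less[OF p, of "?r k"] that assms(2,3) by auto
  ultimately show ?thesis
    using p assms(2,3) unfolding eq by (auto simp: tour_def)
qed

text \<open>Every pair of the new tour other than the two heavy ones at \<open>i\<close> and
  \<open>j\<close> already occurred in the old tour, so light pairs can only disappear and no weight
  below \<open>c\<close> can arise.\<close>

lemma light_reverse_segment:
  assumes imp: "improving c p i j" and j: "j < N"
  shows "card (light c (reverse_segment i j p)) < card (light c p)"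
    and "(\<forall>k<N. c \<le> W (p k) (p (Suc k))) \<Longrightarrow> k < N \<Longrightarrow>
      c \<le> W (reverse_segment i j p k) (reverse_segment i j p (Suc k))"
proof -
  let ?q = "reverse_segment i j p"
  \<comment> \<open>For \<open>k\<close> other than \<open>i\<close> and \<open>j\<close>, this is
    the position in the old tour of the pair that the new tour has at \<open>k\<close>.\<close>
  let ?f = "\<lambda>k. if i < k \<and> k < j then i + j - k else k"
  have ij: "i < j" and heavy: "c < W (p i) (p j)" "c < W (p (Suc i)) (p (Suc j))"
    and light: "i \<in> light c p \<or> j \<in> light c p"
    using imp j by (auto simp: improving_def light_def)
  have step: "W (?q k) (?q (Suc k)) =
      (if k = i then W (p i) (p j) else if k = j then W (p (Suc i)) (p (Suc j))
       else W (p (?f k)) (p (Suc (?f k))))" for k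
  proof -
    consider "k < i" | "k = i" | "i < k" "k < j" | "k = j" | "j < k" by linarith
    then show ?thesis
    proof cases
      case 3
      then have "i + 1 + j - k = Suc (i + j - k)" "i + 1 + j - Suc k = i + j - k" by auto
      then show ?thesis using 3 W_sym by (simp add: reverse_segment_def)
    qed (use ij in \<open>auto simp: reverse_segment_def\<close>)
  qed
  have "inj_on ?f {..<N}" by (auto simp: inj_on_def split: if_splits)
  then have "inj_on ?f (light c ?q)"
    by (rule inj_on_subset) (auto simp: light_def)
  moreover have "?f ` light c ?q \<subseteq> light c p - {i, j}"
  proof
    fix m assume "m \<in> ?f ` light c ?q"
    then obtain k where k: "m = ?f k" "k < N" "W (?q k) (?q (Suc k)) \<le> c"
      unfolding light_def by blast
    then have "k \<noteq> i" "k \<noteq> j" using step[of k] heavy ij by auto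
    then show "m \<in> light c p - {i, j}"
      using k step[of k] j ij by (auto simp: light_def)
  qed
  ultimately have "card (light c ?q) \<le> card (light c p - {i, j})"
    by (rule card_inj_on_le) (simp add: finite_light)
  also have "\<dots> < card (light c p)"
    using light finite_light by (intro psubset_card_mono) auto
  finally show "card (light c ?q) < card (light c p)" .
  show "c \<le> W (?q k) (?q (Suc k))" if "\<forall>k<N. c \<le> W (p k) (p (Suc k))" "k < N" for k
    using that j heavy unfolding step by auto
qed

text \<open>On such a tour the light pairs for \<open>c\<close> are those of weight exactly
  \<open>c\<close>.\<close>

definition level :: "nat \<Rightarrow> (nat \<Rightarrow> nat) \<Rightarrow> bool" where
  "level c p \<longleftrightarrow> tour p \<and> (\<forall>k<N. c \<le> W (p k) (p (Suc k)))"

text \<open>If no move takes place, all tests were made on the same tour, so none of the listed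
  moves improves it. If some move takes place, the number of light pairs has dropped, and later
  moves cannot raise it.\<close>

lemma fold_move:
  assumes "level c p" "\<forall>(i, j)\<in>set xs. j < N"
  defines "q \<equiv> fold (\<lambda>(i, j). move c i j) xs p"
  shows "level c q \<and> (q = p \<and> (\<forall>(i, j)\<in>set xs. \<not> improving c p i j) \<or>
    card (light c q) < card (light c p))"
  using assms(1,2) unfolding q_def
proof (induction xs arbitrary: p)
  case (Cons x xs)
  obtain i j where x: "x = (i, j)" by force
  have j: "j < N" using Cons.prems(2) x by auto
  show ?case
  proof (cases "improving c p i j")
    case True
    let ?p = "reverse_segment i j p"
    have "i < j" using True by (simp add: improving_def)
    then have "level c ?p"
      using tour_reverse_segment[of p i j] light_reverse_segment(2)[OF True j] Cons.prems j
      unfolding level_def by auto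
    from Cons.IH[OF this] show ?thesis
      using True light_reverse_segment(1)[OF True j] Cons.prems x
      by (auto simp: move_def)
  next
    case False
    then show ?thesis using Cons.IH[OF Cons.prems(1)] Cons.prems(2) x by (simp add: move_def)
  qed
qed simp

lemma fold_product:
  "fold (\<lambda>x. fold (f x) ys) xs s = fold (\<lambda>(x, y). f x y) (List.product xs ys) s"
  by (induction xs arbitrary: s) (simp_all add: fold_map comp_def)

text \<open>A pass tries every pair of positions. If it changes nothing, the tour admits no
  improving move, and by \<open>exists_improving\<close> it has no light pair.\<close>

lemma pass_level:
  assumes "level c p" "c < M"
  shows "level c (pass c p)" "light c p = {} \<or> card (light c (pass c p)) < card (light c p)"
    "light c p = {} \<Longrightarrow> pass c p = p"
proof -
  let ?xs = "List.product [0..<N] [0..<N]"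
  have "level c (pass c p) \<and> (pass c p = p \<and> (\<forall>(i, j)\<in>set ?xs. \<not> improving c p i j) \<or>
    card (light c (pass c p)) < card (light c p))"
    unfolding pass_def fold_product by (rule fold_move[OF assms(1)]) auto
  then have *: "level c (pass c p)" "pass c p = p \<and> (\<forall>i<N. \<forall>j<N. \<not> improving c p i j) \<or>
    card (light c (pass c p)) < card (light c p)" by auto
  then show "level c (pass c p)" by simp
  show "light c p = {} \<or> card (light c (pass c p)) < card (light c p)"
    using *(2) exists_improving[of p c] assms by (auto simp: level_def)
  show "light c p = {} \<Longrightarrow> pass c p = p" using *(2) by auto
qed

lemma passes_level:
  assumes "level c p" "c < M"
  shows "level c (fold (\<lambda>_. pass c) [0..<m] p) \<and>
    card (light c (fold (\<lambda>_. pass c) [0..<m] p)) \<le> N - m"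
proof (induction m)
  case 0
  have "card (light c p) \<le> card {..<N}" by (rule card_mono) (auto simp: light_def)
  then show ?case using assms by simp
next
  case (Suc m)
  then show ?case
    using pass_level[of c "fold (\<lambda>_. pass c) [0..<m] p"] assms(2) by auto
qed

text \<open>When level \<open>m\<close> has no light pair left, all consecutive pairs weigh at least
  \<open>Suc m\<close>, which is the hypothesis for the next level.\<close>

lemma optimize_level:
  assumes "tour p"
  shows "level M (optimize p)"
proof -
  have "m \<le> M \<Longrightarrow> level m (fold (\<lambda>c. fold (\<lambda>_. pass c) [0..<N]) [0..<m] p)" for m
  proof (induction m)
    case 0
    then show ?case using assms by (simp add: level_def)
  next
    case (Suc m)
    let ?q = "fold (\<lambda>c. fold (\<lambda>_. pass c) [0..<N]) [0..<Suc m] p"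
    have "level m ?q \<and> card (light m ?q) \<le> 0"
      using passes_level[of m _ N] Suc by simp
    then show ?case using finite_light[of m ?q] by (force simp: level_def light_def not_le Suc_le_eq)
  qed
  then show ?thesis by (simp add: optimize_def)
qed

text \<open>Reversals touch only positions above \<open>i\<close>. This pins the universal vertex to
  the ends of the tour.\<close>

lemma optimize_0: "optimize p 0 = p 0"
proof -
  have m: "move c i j p 0 = p 0" for c i j p
    by (simp add: move_def reverse_segment_def)
  have f: "(\<And>x p. f x p 0 = p 0) \<Longrightarrow> fold f xs p 0 = p 0" 
    for f :: "nat \<Rightarrow> (nat \<Rightarrow> nat) \<Rightarrow> nat \<Rightarrow> nat" and xs p
    by (induction xs arbitrary: p) auto
  show ?thesis unfolding optimize_def pass_def by (intro f m)
qed

end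

section \<open>Odd-even transposition along a Hamiltonian path\<close>

definition swap_round :: "nat \<Rightarrow> (nat \<Rightarrow> nat) \<Rightarrow> nat \<Rightarrow> (nat \<times> nat) list" where
  "swap_round n h r = map (\<lambda>k. (h k, h (Suc k))) (filter (\<lambda>k. even (k + r)) [0..<n - 1])"

definition swap_rounds :: "nat \<Rightarrow> (nat \<Rightarrow> nat) \<Rightarrow> (nat \<times> nat) list list" where
  "swap_rounds n h = map (swap_round n h) [0..<n - 1]"

text \<open>Unfolded on a circle with \<open>2 n\<close> points, the agents all move forward by one point per round:
  a point \<open>x < n\<close> stands for the path vertex \<open>x\<close> and a point \<open>x \<ge> n\<close> for \<open>2 n - 1 - x\<close>.\<close>

definition circle_vertex :: "nat \<Rightarrow> nat \<Rightarrow> nat" where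
  "circle_vertex n x = (if x < n then x else 2 * n - 1 - x)"

text \<open>Each path vertex has two points on the circle, of different parity; the even one is
  chosen, so that all agents start on even points.\<close>

definition circle_point :: "nat \<Rightarrow> nat \<Rightarrow> nat" where
  "circle_point n a = (if even a then a else 2 * n - 1 - a)"

locale ham_path =
  fixes n :: nat and h :: "nat \<Rightarrow> nat" and E :: "nat set set"
  assumes inj: "inj_on h {..<n}"
    and edge: "Suc k < n \<Longrightarrow> {h k, h (Suc k)} \<in> E"
begin

lemma round_matching_swap_round:
  "round_matching (swap_round n h r) = {{h k, h (Suc k)} | k. Suc k < n \<and> even (k + r)}"
  unfolding round_matching_def swap_round_def by force

lemma h_eq_iff: "j < n \<Longrightarrow> k < n \<Longrightarrow> h j = h k \<longleftrightarrow> j = k"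
  using inj by (auto dest: inj_onD)

lemma graph_matching_swap_round: "graph_matching E (round_matching (swap_round n h r))"
  unfolding graph_matching_def round_matching_swap_round pairwise_def
proof (intro conjI ballI impI)
  show "{{h k, h (Suc k)} |k. Suc k < n \<and> even (k + r)} \<subseteq> E" using edge by auto
next
  fix e f assume "e \<in> {{h k, h (Suc k)} |k. Suc k < n \<and> even (k + r)}"
    "f \<in> {{h k, h (Suc k)} |k. Suc k < n \<and> even (k + r)}" "e \<noteq> f"
  then obtain j k where jk: "e = {h j, h (Suc j)}" "f = {h k, h (Suc k)}" "j \<noteq> k"
    "Suc j < n" "Suc k < n" "even (j + r)" "even (k + r)" by auto
  then have "j \<noteq> Suc k" "k \<noteq> Suc j" by auto
  then show "disjnt e f" using jk by (simp add: disjnt_def h_eq_iff)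
qed

text \<open>Agents without a partner at an end of the path stay; for \<open>k = 0\<close> this is
  hidden in the truncated \<open>k - 1\<close>.\<close>

lemma swap_along_swap_round:
  assumes k: "k < n"
  shows "swap_along (round_matching (swap_round n h r)) (h k) =
    h (if even (k + r) then if Suc k < n then Suc k else k else k - 1)"
proof -
  let ?k = "if even (k + r) then if Suc k < n then Suc k else k else k - 1"
  have iff: "{h k, y} \<in> round_matching (swap_round n h r) \<longleftrightarrow> ?k \<noteq> k \<and> y = h ?k" for y
  proof
    assume "{h k, y} \<in> round_matching (swap_round n h r)"
    then obtain j where j: "{h k, y} = {h j, h (Suc j)}" "Suc j < n" "even (j + r)"
      unfolding round_matching_swap_round by auto
    then have "h k = h j \<and> y = h (Suc j) \<or> h k = h (Suc j) \<and> y = h j"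
      by (auto simp: doubleton_eq_iff)
    then have "k = j \<and> y = h (Suc j) \<or> k = Suc j \<and> y = h j"
      using j(2) k by (auto simp: h_eq_iff)
    then show "?k \<noteq> k \<and> y = h ?k" using j by auto
  next
    assume *: "?k \<noteq> k \<and> y = h ?k"
    show "{h k, y} \<in> round_matching (swap_round n h r)"
    proof (cases "even (k + r)")
      case True
      with * have "Suc k < n" "y = h (Suc k)" by (auto split: if_splits)
      with True show ?thesis unfolding round_matching_swap_round by auto
    next
      case False
      with * obtain j where "k = Suc j" "y = h j" by (cases k) auto
      with False k show ?thesis
        unfolding round_matching_swap_round by (auto intro!: exI[of _ j] simp: insert_commute)
    qed
  qed
  show ?thesis unfolding swap_along_def iff by auto
qed

lemma circle_vertex_less: "x < 2 * n \<Longrightarrow> circle_vertex n x < n"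
  by (auto simp: circle_vertex_def)

text \<open>Agents on the first half of the circle walk up the path, those on the second half walk
  down. The steps from point \<open>n - 1\<close> to \<open>n\<close> and from
  \<open>2 * n - 1\<close> to 0 are the rounds spent waiting at an end.\<close>

lemma position_swap_rounds:
  assumes "a < n"
  shows "t \<le> n - 1 \<Longrightarrow> position (take t (map round_matching (swap_rounds n h))) (h a) =
    h (circle_vertex n ((circle_point n a + t) mod (2 * n)))"
proof (induction t)
  case 0
  then show ?case using assms by (auto simp: position_def circle_vertex_def circle_point_def)
next
  case (Suc t)
  let ?c = "circle_point n a"
  define x where "x = (?c + t) mod (2 * n)"
  have x: "x < 2 * n" using assms by (simp add: x_def)
  \<comment> \<open>At time \<open>t\<close> all agents sit on points of the parity of
    \<open>t\<close>, and for these the matching of round \<open>t\<close> is exactly the forward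
    step.\<close>
  have "even ?c" using assms by (auto simp: circle_point_def)
  then have par: "even x \<longleftrightarrow> even t" unfolding x_def by (simp add: dvd_mod_iff)
  have succ: "(?c + Suc t) mod (2 * n) = (if Suc x = 2 * n then 0 else Suc x)"
    unfolding x_def by (simp add: mod_Suc)
  have t: "t < length (swap_rounds n h)" using Suc.prems by (simp add: swap_rounds_def)
  have "position (take (Suc t) (map round_matching (swap_rounds n h))) (h a) =
      swap_along (round_matching (swap_round n h t)) (h (circle_vertex n x))"
    using Suc t by (simp add: take_Suc_conv_app_nth position_def x_def swap_rounds_def)
  also have "\<dots> = h (circle_vertex n (if Suc x = 2 * n then 0 else Suc x))"
    unfolding swap_along_swap_round[OF circle_vertex_less[OF x]]
    using x par by (intro arg_cong[of _ _ h]) (auto simp: circle_vertex_def)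
  finally show ?case unfolding succ .
qed

text \<open>Two agents on points \<open>X \<noteq> Y\<close> with \<open>X + Y = 2 * n - 2\<close>
  occupy neighbouring path vertices. As both advance by one per round, their sum grows by 2 modulo
  \<open>2 * n\<close>, and being even it takes this value at some time up to
  \<open>n - 1\<close>.\<close>

lemma acquainted_swap_rounds:
  assumes ab: "a < n" "b < n" "a \<noteq> b"
  shows "acquainted E (map round_matching (swap_rounds n h)) (h a) (h b)"
proof -
  define x y where "x = circle_point n a" and "y = circle_point n b"
  have xy: "x < 2 * n" "y < 2 * n" "even x" "even y" "x \<noteq> y"
    using ab by (auto simp: x_def y_def circle_point_def)
  obtain s where s: "x + y = 2 * s" using xy by (metis even_add evenE)
  have mod: "u < 2 * m \<Longrightarrow> u mod m = (if u < m then u else u - m)" for u m :: nat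
    by (auto simp: not_less le_mod_geq)
  \<comment> \<open>Solves \<open>2 * s + 2 * t = - 2\<close> modulo \<open>2 * n\<close>, that is,
    \<open>s + t = - 1\<close> modulo \<open>n\<close>.\<close>
  define t where "t = n - 1 - s mod n"
  define X Y where "X = (x + t) mod (2 * n)" and "Y = (y + t) mod (2 * n)"
  have t: "t \<le> n - 1" by (simp add: t_def)
  have s_mod: "s mod n = (if s < n then s else s - n)"
    using mod[of s n] s xy by simp
  have X: "X = (if x + t < 2 * n then x + t else x + t - 2 * n)"
    and Y: "Y = (if y + t < 2 * n then y + t else y + t - 2 * n)"
    using mod[of _ "2 * n"] t xy unfolding X_def Y_def by auto
  have less: "X < 2 * n" "Y < 2 * n" using X Y t xy by (auto split: if_splits)
  have neq: "X \<noteq> Y" using X Y xy by (auto split: if_splits)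
  have st: "s + t = n - 1 \<or> s + t = 2 * n - 1"
    using s_mod s xy ab unfolding t_def by (auto split: if_splits)
  \<comment> \<open>The only other value in range with the same residue is \<open>4 * n - 2\<close>,
    which would force \<open>X = Y = 2 * n - 1\<close>.\<close>
  have "X + Y = 2 * n - 2"
    using X Y st s less neq t xy by (auto split: if_splits)
  then have "{h (circle_vertex n X), h (circle_vertex n Y)} \<in> E"
  proof (cases "X < Y")
    case True
    then have "Suc X < n" "circle_vertex n X = X" "circle_vertex n Y = Suc X"
      using \<open>X + Y = 2 * n - 2\<close> ab by (auto simp: circle_vertex_def)
    then show ?thesis using edge by simp
  next
    case False
    then have "Suc Y < n" "circle_vertex n Y = Y" "circle_vertex n X = Suc Y"
      using \<open>X + Y = 2 * n - 2\<close> neq ab by (auto simp: circle_vertex_def)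
    then show ?thesis using edge by (simp add: insert_commute)
  qed
  then show ?thesis
    using position_swap_rounds[OF ab(1) t] position_swap_rounds[OF ab(2) t] t
    unfolding acquainted_def X_def Y_def x_def y_def
    by (intro exI[of _ t]) (simp add: swap_rounds_def)
qed

lemma acquaintance_strategy_swap_rounds:
  assumes "h ` {..<n} = V"
  shows "acquaintance_strategy V E (map round_matching (swap_rounds n h))"
  unfolding acquaintance_strategy_def
  using assms acquainted_swap_rounds graph_matching_swap_round
  by (auto simp: swap_rounds_def)

end

section \<open>The program\<close>

lemma mem_put: "mem (put a i v s) b = (if b = a then (mem s a)(i := v) else mem s b)"
  by (simp add: put_def)

lemma put_io [simp]: "unread (put a i v s) = unread s" "written (put a i v s) = written s"
  by (simp_all add: put_def)

section \<open>Frame properties and loop invariants\<close>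

fun writes :: "com \<Rightarrow> nat set" where
  "writes (Assign a e f) = {a}"
| "writes (c ;; d) = writes c \<union> writes d"
| "writes (Cond e c d) = writes c \<union> writes d"
| "writes (For x a b c) = insert x (writes c)"
| "writes (Get x) = {x}"
| "writes _ = {}"

fun silent :: "com \<Rightarrow> bool" where
  "silent (c ;; d) \<longleftrightarrow> silent c \<and> silent d"
| "silent (Cond e c d) \<longleftrightarrow> silent c \<and> silent d"
| "silent (For x a b c) \<longleftrightarrow> silent c"
| "silent (Put e) \<longleftrightarrow> False"
| "silent _ \<longleftrightarrow> True"

lemma For_rule:
  assumes "m = a * n + b" "I 0 s"
    and "\<And>i s. i < m \<Longrightarrow> I i s \<Longrightarrow> I (Suc i) (exec n c (put x 0 i s))"
  shows "I m (exec n (For x a b c) s)"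
proof -
  have "k \<le> m \<Longrightarrow> I k (fold (\<lambda>i s. exec n c (put x 0 i s)) [0..<k] s)" for k
    by (induction k) (use assms in auto)
  then show ?thesis using assms(1) by simp
qed

lemma mem_exec: "a \<notin> writes c \<Longrightarrow> mem (exec n c s) a = mem s a"
proof (induction c arbitrary: s)
  case (For x p q c)
  show ?case
    by (rule For_rule[OF refl, where I = "\<lambda>_ s'. mem s' a = mem s a"])
      (use For in \<open>auto simp: mem_put\<close>)
next
  case (Get x)
  then show ?case by (auto simp: mem_put split: list.split)
qed (auto simp: mem_put)

lemma written_exec: "silent c \<Longrightarrow> written (exec n c s) = written s"
proof (induction c arbitrary: s)
  case (For x p q c)
  show ?case
    by (rule For_rule[OF refl, where I = "\<lambda>_ s'. written s' = written s"])
      (use For in auto)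
next
  case (Get x)
  then show ?case by (auto split: list.split)
qed auto

lemma cell_eq_iff:
  fixes u v u' v' :: nat
  assumes "v \<le> n" "v' \<le> n"
  shows "u * Suc n + v = u' * Suc n + v' \<longleftrightarrow> u = u' \<and> v = v'"
proof
  assume *: "u * Suc n + v = u' * Suc n + v'"
  have "(u * Suc n + v) div Suc n = u" "(u' * Suc n + v') div Suc n = u'"
    using assms by (simp_all del: mult_Suc_right)
  with * have "u = u'" by metis
  with * show "u = u' \<and> v = v'" by simp
qed simp

abbreviation (input) "Xu \<equiv> 0 :: nat"
abbreviation (input) "Xv \<equiv> 1 :: nat"
abbreviation (input) "Xi \<equiv> 2 :: nat"
abbreviation (input) "Xj \<equiv> 3 :: nat"
abbreviation (input) "Xk \<equiv> 4 :: nat"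
abbreviation (input) "Xc \<equiv> 5 :: nat"
abbreviation (input) "Xr \<equiv> 6 :: nat"
abbreviation (input) "Xx \<equiv> 7 :: nat"
abbreviation (input) "Xy \<equiv> 8 :: nat"
abbreviation (input) "ADJ \<equiv> 10 :: nat"
abbreviation (input) "ROW \<equiv> 11 :: nat"
abbreviation (input) "DEG \<equiv> 12 :: nat"
abbreviation (input) "WGT \<equiv> 13 :: nat"
abbreviation (input) "PATH \<equiv> 14 :: nat"
abbreviation (input) "COPY \<equiv> 15 :: nat"
abbreviation (input) "PAR \<equiv> 16 :: nat"

abbreviation (input) "cell e f \<equiv> Plus (Arr ROW e) f"

text \<open>The matrix gets an extra row and column \<open>n\<close> of ones, for a vertex joined to all others.\<close>

definition load_matrix :: com where
  "load_matrix =
     For Xu 1 1 (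
       Assign ROW (Var Xu) (Var Xx) ;;
       For Xv 1 1 (
         Cond (Minus Size (Var Xu))
           (Cond (Minus Size (Var Xv)) (Get Xy) (Set Xy (Num 1)))
           (Set Xy (Num 1)) ;;
         Assign ADJ (Var Xx) (Var Xy) ;;
         Set Xx (Plus (Var Xx) (Num 1))))"

definition extended :: "nat \<Rightarrow> (nat \<Rightarrow> nat \<Rightarrow> nat) \<Rightarrow> nat \<Rightarrow> nat \<Rightarrow> nat" where
  "extended n f u v = (if u < n \<and> v < n then f u v else 1)"

definition stores :: "nat \<Rightarrow> nat \<Rightarrow> (nat \<Rightarrow> nat \<Rightarrow> nat) \<Rightarrow> state \<Rightarrow> bool" where
  "stores n a f s \<longleftrightarrow> (\<forall>u\<le>n. \<forall>v\<le>n. mem s a (u * Suc n + v) = f u v)"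

definition rows :: "nat \<Rightarrow> state \<Rightarrow> bool" where
  "rows n s \<longleftrightarrow> (\<forall>u\<le>n. mem s ROW u = u * Suc n)"

lemma load_matrix_correct:
  assumes "unread s = concat (map (\<lambda>i. map (f i) [0..<n]) [0..<n])" "mem s Xx 0 = 0"
  shows "rows n (exec n load_matrix s) \<and> stores n ADJ (extended n f) (exec n load_matrix s)"
proof -
  \<comment> \<open>The tape still unread when cell \<open>(u, v)\<close> comes next; the artificial
    row and column consume no input.\<close>
  define rest where "rest u v = (if u < n
      then map (f u) [v..<n] @ concat (map (\<lambda>i. map (f i) [0..<n]) [Suc u..<n]) else [])" for u v
  define I where "I u v s \<longleftrightarrow> mem s Xx 0 = u * Suc n + v \<and>
     (\<forall>u' v'. v' \<le> n \<and> (u' < u \<or> u' = u \<and> v' < v) \<longrightarrow>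
        mem s ADJ (u' * Suc n + v') = extended n f u' v') \<and> unread s = rest u v" for u v and s :: state
  define J where "J u s \<longleftrightarrow> (\<forall>u'<u. mem s ROW u' = u' * Suc n) \<and> I u 0 s" for u and s :: state
  have "J (Suc n) (exec n load_matrix s)"
    unfolding load_matrix_def
  proof (rule For_rule)
    show "J 0 s"
      using assms by (cases n) (auto simp: J_def I_def rest_def upt_rec[of 0])
  next
    fix u s assume u: "u < Suc n" and J: "J u s"
    define s1 where "s1 = exec n (Assign ROW (Var Xu) (Var Xx)) (put Xu 0 u s)"
    have s1: "mem s1 Xu 0 = u" "\<forall>u'<Suc u. mem s1 ROW u' = u' * Suc n" "I u 0 s1"
      using J by (auto simp: s1_def J_def I_def mem_put less_Suc_eq)
    let ?body = "Cond (Minus Size (Var Xu))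
           (Cond (Minus Size (Var Xv)) (Get Xy) (Set Xy (Num 1)))
           (Set Xy (Num 1)) ;;
         Assign ADJ (Var Xx) (Var Xy) ;;
         Set Xx (Plus (Var Xx) (Num 1))"
    have inner: "I u (Suc n) (exec n (For Xv 1 1 ?body) s1) \<and>
        mem (exec n (For Xv 1 1 ?body) s1) Xu 0 = u"
    proof (rule For_rule[where I = "\<lambda>v s. I u v s \<and> mem s Xu 0 = u"])
      show "I u 0 s1 \<and> mem s1 Xu 0 = u" using s1 by simp
    next
      fix v s assume v: "v < Suc n" and I: "I u v s \<and> mem s Xu 0 = u"
      define s2 where "s2 = exec n (Cond (Minus Size (Var Xu))
           (Cond (Minus Size (Var Xv)) (Get Xy) (Set Xy (Num 1)))
           (Set Xy (Num 1))) (put Xv 0 v s)"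
      have "rest u v = f u v # rest u (Suc v)" if "u < n" "v < n"
        using that by (simp add: rest_def upt_conv_Cons)
      moreover have "rest u v = rest u (Suc v)" if "\<not> (u < n \<and> v < n)"
        using that by (auto simp: rest_def)
      ultimately have s2: "mem s2 Xy 0 = extended n f u v" "unread s2 = rest u (Suc v)"
        using I by (auto simp: s2_def I_def mem_put extended_def)
      have "mem s2 a = mem s a" if "a \<noteq> Xy" "a \<noteq> Xv" for a
        using that unfolding s2_def by (subst mem_exec) (auto simp: mem_put)
      then have m: "mem s2 Xx = mem s Xx" "mem s2 ADJ = mem s ADJ" "mem s2 Xu = mem s Xu" by auto
      have "exec n ?body (put Xv 0 v s) =
          put Xx 0 (Suc (u * Suc n + v)) (put ADJ (u * Suc n + v) (extended n f u v) s2)"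
        unfolding exec.simps(3) s2_def[symmetric]
        using s2 m I by (simp add: mem_put I_def del: mult_Suc_right)
      moreover have "u' * Suc n + v' \<noteq> u * Suc n + v"
        if "v' \<le> n" "u' < u \<or> u' = u \<and> v' < v" for u' v'
        using that v cell_eq_iff[of v' n v u' u] by auto
      ultimately show "I u (Suc v) (exec n ?body (put Xv 0 v s)) \<and>
          mem (exec n ?body (put Xv 0 v s)) Xu 0 = u"
        using I s2 m by (auto simp: I_def mem_put less_Suc_eq simp del: mult_Suc_right)
    qed simp
    have "I (Suc u) 0 s'" if "I u (Suc n) s'" for s'
      using that u unfolding I_def rest_def
      by (cases "Suc u < n")
        (auto simp: less_Suc_eq[of _ u] less_Suc_eq_le[of _ n] upt_conv_Cons)
    moreover have "mem (exec n (For Xv 1 1 ?body) s1) ROW = mem s1 ROW"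
      by (rule mem_exec) simp
    ultimately show "J (Suc u) (exec n (Assign ROW (Var Xu) (Var Xx) ;; For Xv 1 1 ?body) (put Xu 0 u s))"
      using inner s1(2) unfolding J_def by (simp add: s1_def[symmetric] del: exec.simps(2,5))
  qed simp
  then show ?thesis by (auto simp: J_def I_def rows_def stores_def)
qed

text \<open>Degrees are counted among the original vertices only. The universal vertex has ones in
  its whole row and column, so its entry of \<open>DEG\<close> is never read.\<close>

definition compute_weights :: com where
  "compute_weights =
     For Xu 1 0 (For Xv 1 0 (
       When (Arr ADJ (cell (Var Xu) (Var Xv)))
         (Assign DEG (Var Xu) (Plus (Arr DEG (Var Xu)) (Num 1))))) ;;
     For Xu 1 1 (For Xv 1 1 (
       Cond (Arr ADJ (cell (Var Xu) (Var Xv)))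
         (Assign WGT (cell (Var Xu) (Var Xv)) (Plus (Plus Size Size) (Num 2)))
         (Assign WGT (cell (Var Xu) (Var Xv))
            (Plus (Arr DEG (Var Xu)) (Arr DEG (Var Xv))))))"

definition row_count :: "nat \<Rightarrow> (nat \<Rightarrow> nat \<Rightarrow> nat) \<Rightarrow> nat \<Rightarrow> nat" where
  "row_count n f u = card {v. v < n \<and> f u v \<noteq> 0}"

text \<open>The counterpart of \<open>weight\<close> for matrices, where pairs with the universal
  vertex weigh as much as edges.\<close>

definition weight_matrix :: "nat \<Rightarrow> (nat \<Rightarrow> nat \<Rightarrow> nat) \<Rightarrow> nat \<Rightarrow> nat \<Rightarrow> nat" where
  "weight_matrix n f u v = (if extended n f u v \<noteq> 0 then 2 * n + 2
     else row_count n f u + row_count n f v)"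

lemma row_count_Suc:
  "row_count (Suc n) f u = (if f u n = 0 then row_count n f u else Suc (row_count n f u))"
proof -
  have "{v. v < Suc n \<and> f u v \<noteq> 0} =
      (if f u n = 0 then {v. v < n \<and> f u v \<noteq> 0} else insert n {v. v < n \<and> f u v \<noteq> 0})"
    by (auto simp: less_Suc_eq)
  then show ?thesis by (simp add: row_count_def)
qed

lemma compute_weights_correct:
  assumes "rows n s" "stores n ADJ (extended n f) s" "mem s DEG = (\<lambda>_. 0)"
  shows "stores n WGT (weight_matrix n f) (exec n compute_weights s)"
proof -
  let ?b1 = "When (Arr ADJ (cell (Var Xu) (Var Xv)))
      (Assign DEG (Var Xu) (Plus (Arr DEG (Var Xu)) (Num 1)))"
  let ?b2 = "Cond (Arr ADJ (cell (Var Xu) (Var Xv)))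
         (Assign WGT (cell (Var Xu) (Var Xv)) (Plus (Plus Size Size) (Num 2)))
         (Assign WGT (cell (Var Xu) (Var Xv))
            (Plus (Arr DEG (Var Xu)) (Arr DEG (Var Xv))))"
  let ?L1 = "For Xu 1 0 (For Xv 1 0 ?b1)" and ?L2 = "For Xu 1 1 (For Xv 1 1 ?b2)"
  define R where "R s \<longleftrightarrow> rows n s \<and> stores n ADJ (extended n f) s" for s
  have R_put: "R (put a i v s) \<longleftrightarrow> R s" if "a \<noteq> ROW" "a \<noteq> ADJ" for a i v s
    using that by (simp add: R_def rows_def stores_def mem_put)
  have cell: "mem s ADJ (mem s ROW u + v) = extended n f u v" "mem s ROW u = u * Suc n"
    if "R s" "u \<le> n" "v \<le> n" for s u v
    using that by (simp_all add: R_def rows_def stores_def)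
  define D where "D u v u' = (if u' < u then row_count n f u' else if u' = u then row_count v f u else 0)"
    for u v u'
  have D0: "D u 0 = (\<lambda>u'. if u' < u then row_count n f u' else 0)" for u
    by (auto simp: D_def row_count_def)
  have 1: "R (exec n ?L1 s) \<and> mem (exec n ?L1 s) DEG = D n 0"
  proof (rule For_rule[where I = "\<lambda>u s. R s \<and> mem s DEG = D u 0"])
    show "R s \<and> mem s DEG = D 0 0" using assms by (simp add: R_def D0)
  next
    fix u s assume u: "u < n" and s: "R s \<and> mem s DEG = D u 0"
    have "R (exec n (For Xv 1 0 ?b1) (put Xu 0 u s)) \<and>
        mem (exec n (For Xv 1 0 ?b1) (put Xu 0 u s)) DEG = D u n \<and>
        mem (exec n (For Xv 1 0 ?b1) (put Xu 0 u s)) Xu 0 = u"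
    proof (rule For_rule[where I = "\<lambda>v s. R s \<and> mem s DEG = D u v \<and> mem s Xu 0 = u"])
      show "R (put Xu 0 u s) \<and> mem (put Xu 0 u s) DEG = D u 0 \<and> mem (put Xu 0 u s) Xu 0 = u"
        using s by (simp add: R_put mem_put)
    next
      fix v s assume v: "v < n" and s: "R s \<and> mem s DEG = D u v \<and> mem s Xu 0 = u"
      have "D u (Suc v) = (D u v)(u := (if f u v = 0 then D u v u else Suc (D u v u)))"
        by (auto simp: D_def row_count_Suc)
      moreover have "mem s ADJ (mem s ROW u + v) = f u v"
        using cell[of s u v] s u v by (simp add: extended_def)
      ultimately show "R (exec n ?b1 (put Xv 0 v s)) \<and> mem (exec n ?b1 (put Xv 0 v s)) DEG = D u (Suc v) \<and>
          mem (exec n ?b1 (put Xv 0 v s)) Xu 0 = u"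
        using s by (auto simp: R_put mem_put)
    qed simp
    moreover have "D u n = D (Suc u) 0" by (auto simp: D_def row_count_def less_Suc_eq)
    ultimately show "R (exec n (For Xv 1 0 ?b1) (put Xu 0 u s)) \<and>
        mem (exec n (For Xv 1 0 ?b1) (put Xu 0 u s)) DEG = D (Suc u) 0" by simp
  qed simp
  define S where "S s \<longleftrightarrow> R s \<and> mem s DEG = D n 0" for s
  have S_put: "S (put a i v s) \<longleftrightarrow> S s" if "a \<noteq> ROW" "a \<noteq> ADJ" "a \<noteq> DEG" for a i v s
    using that by (simp add: S_def R_put mem_put)
  define I where "I u v s \<longleftrightarrow> S s \<and> (\<forall>u' v'. u' \<le> n \<and> v' \<le> n \<and> (u' < u \<or> u' = u \<and> v' < v) \<longrightarrow>
        mem s WGT (u' * Suc n + v') = weight_matrix n f u' v')" for u v s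
  have I_put: "I u v (put a i w s) \<longleftrightarrow> I u v s" if "a = Xu \<or> a = Xv" for a i w s u v
    using that by (auto simp: I_def S_put mem_put)
  have "I (Suc n) 0 (exec n ?L2 (exec n ?L1 s))"
  proof (rule For_rule[where I = "\<lambda>u. I u 0"])
    show "I 0 0 (exec n ?L1 s)" using 1 by (simp add: I_def S_def)
  next
    fix u s assume u: "u < Suc n" and I: "I u 0 s"
    have "I u (Suc n) (exec n (For Xv 1 1 ?b2) (put Xu 0 u s)) \<and>
        mem (exec n (For Xv 1 1 ?b2) (put Xu 0 u s)) Xu 0 = u"
    proof (rule For_rule[where I = "\<lambda>v s. I u v s \<and> mem s Xu 0 = u"])
      show "I u 0 (put Xu 0 u s) \<and> mem (put Xu 0 u s) Xu 0 = u"
        using I by (simp add: I_put mem_put)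
    next
      fix v s assume v: "v < Suc n" and s: "I u v s \<and> mem s Xu 0 = u"
      then have S: "S s" by (simp add: I_def)
      have c: "mem s ADJ (mem s ROW u + v) = extended n f u v" "mem s ROW u = u * Suc n"
        using cell[of s u v] S u v by (simp_all add: S_def)
      have "weight_matrix n f u v = D n 0 u + D n 0 v" if "extended n f u v = 0"
        using that by (auto simp: weight_matrix_def extended_def D0 split: if_splits)
      then have "exec n ?b2 (put Xv 0 v s) =
          put WGT (u * Suc n + v) (weight_matrix n f u v) (put Xv 0 v s)"
        using S s c(1)[unfolded c(2)] c(2)
        by (auto simp: mem_put S_def weight_matrix_def mult_2 simp del: mult_Suc_right)
      moreover have "u' * Suc n + v' \<noteq> u * Suc n + v"
        if "v' \<le> n" "u' < u \<or> u' = u \<and> v' < v" for u' v'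
        using that v cell_eq_iff[of v' n v u' u] by auto
      ultimately show "I u (Suc v) (exec n ?b2 (put Xv 0 v s)) \<and>
          mem (exec n ?b2 (put Xv 0 v s)) Xu 0 = u"
        using s unfolding I_def by (auto simp: S_put mem_put less_Suc_eq simp del: mult_Suc_right)
    qed simp
    then show "I (Suc u) 0 (exec n (For Xv 1 1 ?b2) (put Xu 0 u s))"
      by (auto simp: I_def less_Suc_eq[of _ u] less_Suc_eq_le[of _ n] simp del: exec.simps)
  qed simp
  then show ?thesis
    unfolding compute_weights_def by (auto simp: stores_def I_def simp del: exec.simps(5))
qed

section \<open>The tour in memory: \<open>n, 0, 1, ..., n - 1, n\<close> at the start, then improved
  in place\<close>

definition init_path :: com where
  "init_path = Set PATH Size ;; For Xk 1 1 (Assign PATH (Plus (Var Xk) (Num 1)) (Var Xk))"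

lemma init_path_correct:
  "mem (exec n init_path s) PATH 0 = n \<and> (\<forall>k\<le>n. mem (exec n init_path s) PATH (Suc k) = k)"
proof -
  let ?b = "Assign PATH (Plus (Var Xk) (Num 1)) (Var Xk)"
  let ?I = "\<lambda>i (s :: state). mem s PATH 0 = n \<and> (\<forall>k<i. mem s PATH (Suc k) = k)"
  have "?I (Suc n) (exec n (For Xk 1 1 ?b) (exec n (Set PATH Size) s))"
    by (rule For_rule[where I = ?I]) (auto simp: mem_put less_Suc_eq)
  then show ?thesis by (simp add: init_path_def less_Suc_eq_le del: exec.simps(5))
qed

text \<open>Reading from a copy avoids cells that are already overwritten. The guards are truncated
  differences, nonzero exactly for \<open>i < k\<close> and for \<open>k \<le> j\<close>.\<close>

definition reverse_path :: com where
  "reverse_path =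
     For Xk 1 2 (Assign COPY (Var Xk) (Arr PATH (Var Xk))) ;;
     For Xk 1 1 (When (Minus (Var Xk) (Var Xi)) (When (Minus (Plus (Var Xj) (Num 1)) (Var Xk))
       (Assign PATH (Var Xk)
          (Arr COPY (Minus (Plus (Plus (Var Xi) (Num 1)) (Var Xj)) (Var Xk))))))"

lemma reverse_path_correct:
  assumes ij: "mem s Xi 0 = i" "mem s Xj 0 = j" "i < j" "j \<le> n"
  shows "mem (exec n reverse_path s) PATH = reverse_segment i j (mem s PATH)"
proof -
  define p where "p = mem s PATH"
  let ?b1 = "Assign COPY (Var Xk) (Arr PATH (Var Xk))"
  let ?b2 = "When (Minus (Var Xk) (Var Xi)) (When (Minus (Plus (Var Xj) (Num 1)) (Var Xk))
       (Assign PATH (Var Xk)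
          (Arr COPY (Minus (Plus (Plus (Var Xi) (Num 1)) (Var Xj)) (Var Xk)))))"
  let ?S = "\<lambda>s :: state. mem s Xi 0 = i \<and> mem s Xj 0 = j"
  let ?s1 = "exec n (For Xk 1 2 ?b1) s"
  have 1: "?S ?s1 \<and> mem ?s1 PATH = p \<and> (\<forall>k<n + 2. mem ?s1 COPY k = p k)"
    by (rule For_rule[where I = "\<lambda>m s. ?S s \<and> mem s PATH = p \<and> (\<forall>k<m. mem s COPY k = p k)"])
      (use ij in \<open>auto simp: mem_put p_def less_Suc_eq\<close>)
  let ?C = "\<lambda>s :: state. \<forall>k<n + 2. mem s COPY k = p k"
  let ?I = "\<lambda>m (s :: state). ?S s \<and> ?C s \<and>
      mem s PATH = (\<lambda>k. if k < m then reverse_segment i j p k else p k)"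
  have "?I (Suc n) (exec n (For Xk 1 1 ?b2) ?s1)"
  proof (rule For_rule[where I = ?I])
    show "?I 0 ?s1" using 1 by simp
  next
    fix m s assume m: "m < Suc n" and s: "?I m s"
    show "?I (Suc m) (exec n ?b2 (put Xk 0 m s))"
    proof (cases "i < m \<and> m \<le> j")
      case True
      then have "i + 1 + j - m < n + 2" using ij m by auto
      then show ?thesis using s True
        by (auto simp: mem_put reverse_segment_def less_Suc_eq fun_eq_iff)
    next
      case False
      then show ?thesis using s
        by (auto simp: mem_put reverse_segment_def less_Suc_eq fun_eq_iff)
    qed
  qed simp
  moreover have "(\<lambda>k. if k < Suc n then reverse_segment i j p k else p k) = reverse_segment i j p"
    using ij by (auto simp: reverse_segment_def fun_eq_iff)
  ultimately show ?thesis
    unfolding reverse_path_def p_def by (simp del: exec.simps(5))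
qed


text \<open>Truncated subtraction serves as strict comparison, addition of two tests as disjunction,
  and \<open>C\<close>, which is \<open>c + 1\<close>, turns \<open>\<le> c\<close> into a strict
  comparison.\<close>

definition try_move :: com where
  "try_move =
     (let P = Arr PATH (Var Xi); P' = Arr PATH (Plus (Var Xi) (Num 1));
          Q = Arr PATH (Var Xj); Q' = Arr PATH (Plus (Var Xj) (Num 1));
          w = (\<lambda>e f. Arr WGT (cell e f)); C = Plus (Var Xc) (Num 1)
      in When (Minus (Var Xj) (Var Xi))
        (When (Plus (Minus C (w P P')) (Minus C (w Q Q')))
          (When (Minus (w P Q) (Var Xc))
            (When (Minus (w P' Q') (Var Xc)) reverse_path))))"

definition optimize_path :: com where
  "optimize_path = For Xc 2 2 (For Xr 1 1 (For Xi 1 1 (For Xj 1 1 try_move)))"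

lemma writes_reverse_path: "writes reverse_path = {Xk, COPY, PATH}"
  by (auto simp: reverse_path_def)

lemma writes_try_move: "writes try_move = {Xk, COPY, PATH}"
  by (auto simp: try_move_def writes_reverse_path Let_def)

text \<open>Reads a loop as a fold on the contents of the one array \<open>y\<close>, so that nested
  loops match the nested folds of \<open>optimize\<close>.\<close>

lemma For_transform:
  assumes "m = a * n + b" "R s" "\<And>i s. R s \<Longrightarrow> R (put x 0 i s)" "x \<noteq> y"
    and "\<And>i s. i < m \<Longrightarrow> R s \<Longrightarrow> mem s x 0 = i \<Longrightarrow>
      R (exec n c s) \<and> mem (exec n c s) y = g i (mem s y)"
  shows "R (exec n (For x a b c) s) \<and>
    mem (exec n (For x a b c) s) y = fold g [0..<m] (mem s y)"
proof (rule For_rule[where I = "\<lambda>i s'. R s' \<and> mem s' y = fold g [0..<i] (mem s y)"])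
  fix i s' assume i: "i < m" and "R s' \<and> mem s' y = fold g [0..<i] (mem s y)"
  then show "R (exec n c (put x 0 i s')) \<and>
      mem (exec n c (put x 0 i s')) y = fold g [0..<Suc i] (mem s y)"
    using assms(5)[OF i, of "put x 0 i s'"] assms(3)[of s' i] assms(4) by (simp add: mem_put)
qed (use assms in auto)

context two_opt
begin

lemma tour_move: "tour p \<Longrightarrow> j < N \<Longrightarrow> tour (move c i j p)"
  using tour_reverse_segment by (auto simp: move_def improving_def)

definition ready :: "nat \<Rightarrow> state \<Rightarrow> bool" where
  "ready n s \<longleftrightarrow> rows n s \<and> stores n WGT W s \<and> tour (mem s PATH)"

lemma ready_put: "a \<notin> {ROW, WGT, PATH} \<Longrightarrow> ready n s \<Longrightarrow> ready n (put a i v s)"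
  by (simp add: ready_def rows_def stores_def mem_put)

lemma try_move_correct:
  assumes n: "N = Suc n" and R: "ready n s"
    and s: "mem s Xc 0 = c" "mem s Xi 0 = i" "mem s Xj 0 = j" and ij: "i < N" "j < N"
  shows "ready n (exec n try_move s) \<and> mem (exec n try_move s) PATH = move c i j (mem s PATH)"
proof -
  define p where "p = mem s PATH"
  have tour: "tour p" using R by (simp add: ready_def p_def)
  have W: "mem s WGT (mem s ROW (p a) + p b) = W (p a) (p b)" if "a \<le> N" "b \<le> N" for a b
  proof -
    have "rows n s" "stores n WGT W s" using R by (simp_all add: ready_def)
    moreover have "p a \<le> n" "p b \<le> n"
      using tour_less[OF tour that(1)] tour_less[OF tour that(2)] n by simp_all
    ultimately show ?thesis by (simp add: rows_def stores_def)
  qed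
  have "exec n try_move s = (if improving c p i j then exec n reverse_path s else s)"
    using W[of i "Suc i"] W[of j "Suc j"] W[of i j] W[of "Suc i" "Suc j"] ij s
    by (auto simp: try_move_def improving_def Let_def p_def[symmetric])
  moreover have "mem (exec n reverse_path s) PATH = reverse_segment i j p" if "improving c p i j"
    using reverse_path_correct[OF s(2,3)] that ij n by (simp add: improving_def p_def)
  ultimately have m: "mem (exec n try_move s) PATH = move c i j p"
    by (auto simp: move_def p_def)
  moreover have "mem (exec n try_move s) a = mem s a" if "a = ROW \<or> a = WGT" for a
    using that by (intro mem_exec) (auto simp: writes_try_move)
  ultimately show ?thesis
    using R tour_move[OF tour ij(2), of c i]
    by (simp add: ready_def rows_def stores_def p_def)
qed

lemma optimize_path_correct:
  assumes n: "N = Suc n" "M = 2 * n + 2" and R: "ready n s"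
  shows "mem (exec n optimize_path s) PATH = optimize (mem s PATH)"
proof -
  have keep: "mem (exec n try_move s) a = mem s a" if "a = Xc \<or> a = Xr \<or> a = Xi \<or> a = Xj" for a s
    using that by (intro mem_exec) (auto simp: writes_try_move)
  have 1: "(ready n (exec n (For Xj 1 1 try_move) s) \<and>
        mem (exec n (For Xj 1 1 try_move) s) Xc 0 = c \<and> mem (exec n (For Xj 1 1 try_move) s) Xi 0 = i) \<and>
      mem (exec n (For Xj 1 1 try_move) s) PATH = fold (move c i) [0..<N] (mem s PATH)"
    if "ready n s \<and> mem s Xc 0 = c \<and> mem s Xi 0 = i" "i < N" for s c i
  proof (rule For_transform[where R = "\<lambda>s. ready n s \<and> mem s Xc 0 = c \<and> mem s Xi 0 = i"])
    fix j s assume "j < N" "ready n s \<and> mem s Xc 0 = c \<and> mem s Xi 0 = i" "mem s Xj 0 = j"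
    then show "(ready n (exec n try_move s) \<and> mem (exec n try_move s) Xc 0 = c \<and>
        mem (exec n try_move s) Xi 0 = i) \<and>
        mem (exec n try_move s) PATH = move c i j (mem s PATH)"
      using try_move_correct[OF n(1), of s c i j] that(2) keep by simp
  qed (use that n ready_put in \<open>auto simp: mem_put\<close>)
  let ?b2 = "For Xi 1 1 (For Xj 1 1 try_move)"
  have 2: "(ready n (exec n ?b2 s) \<and> mem (exec n ?b2 s) Xc 0 = c) \<and>
      mem (exec n ?b2 s) PATH = pass c (mem s PATH)"
    if "ready n s \<and> mem s Xc 0 = c" for s c
    unfolding pass_def
  proof (rule For_transform[where R = "\<lambda>s. ready n s \<and> mem s Xc 0 = c"])
    fix i s assume "i < N" "ready n s \<and> mem s Xc 0 = c" "mem s Xi 0 = i"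
    then show "(ready n (exec n (For Xj 1 1 try_move) s) \<and> mem (exec n (For Xj 1 1 try_move) s) Xc 0 = c) \<and>
        mem (exec n (For Xj 1 1 try_move) s) PATH = fold (move c i) [0..<N] (mem s PATH)"
      using 1[of s c i] by simp
  qed (use that n ready_put in \<open>auto simp: mem_put\<close>)
  have 3: "(ready n (exec n (For Xr 1 1 ?b2) s) \<and> mem (exec n (For Xr 1 1 ?b2) s) Xc 0 = c) \<and>
      mem (exec n (For Xr 1 1 ?b2) s) PATH = fold (\<lambda>_. pass c) [0..<N] (mem s PATH)"
    if "ready n s \<and> mem s Xc 0 = c" for s c
    by (rule For_transform[where R = "\<lambda>s. ready n s \<and> mem s Xc 0 = c"])
      (use that n ready_put 2 in \<open>auto simp: mem_put simp del: exec.simps\<close>)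
  have "ready n (exec n optimize_path s) \<and> mem (exec n optimize_path s) PATH = optimize (mem s PATH)"
    unfolding optimize_def optimize_path_def
    by (rule For_transform[where R = "ready n"])
      (use n R ready_put 3 in \<open>auto simp: mem_put simp del: exec.simps\<close>)
  then show ?thesis by simp
qed

end

text \<open>The length of a round is printed before its edges, so each round is scanned twice. Loop
  lengths have the form \<open>a * n + b\<close> and cannot be \<open>n - 1\<close>; the loops run
  to \<open>n\<close> and their last iteration is disabled by a test. \<open>PAR\<close> tabulates
  parities.\<close>

definition emit_rounds :: com where
  "emit_rounds =
     (let last = Minus Size (Num 1);
          on_swap = (\<lambda>c. When (Minus last (Var Xk))
            (When (Minus (Num 1) (Arr PAR (Plus (Var Xk) (Var Xr)))) c))
      in For Xk 2 0 (Assign PAR (Plus (Var Xk) (Num 1)) (Minus (Num 1) (Arr PAR (Var Xk)))) ;;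
         Put last ;;
         For Xr 1 0 (When (Minus last (Var Xr))
           (Set Xx (Num 0) ;;
            For Xk 1 0 (on_swap (Set Xx (Plus (Var Xx) (Num 1)))) ;;
            Put (Var Xx) ;;
            For Xk 1 0 (on_swap (Put (Arr PATH (Plus (Var Xk) (Num 1))) ;;
                                 Put (Arr PATH (Plus (Var Xk) (Num 2))))))))"

lemma emit_rounds_correct:
  assumes "mem s PAR 0 = 0"
  shows "written (exec n emit_rounds s) =
    written s @ encode_strategy (swap_rounds n (\<lambda>k. mem s PATH (Suc k)))"
proof -
  define p where "p = mem s PATH"
  let ?h = "\<lambda>k. p (Suc k)"
  define on_swap where "on_swap c = When (Minus (Minus Size (Num 1)) (Var Xk))
      (When (Minus (Num 1) (Arr PAR (Plus (Var Xk) (Var Xr)))) c)" for c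
  define R where "R s \<longleftrightarrow> mem s PATH = p \<and> (\<forall>j\<le>2 * n. mem s PAR j = j mod 2)" for s :: state
  have R_put: "R (put a i v s) \<longleftrightarrow> R s" if "a \<noteq> PATH" "a \<noteq> PAR" for a i v s
    using that by (simp add: R_def mem_put)
  let ?par = "For Xk 2 0 (Assign PAR (Plus (Var Xk) (Num 1)) (Minus (Num 1) (Arr PAR (Var Xk))))"
  define s1 where "s1 = exec n ?par s"
  have "mem s1 PATH = p \<and> (\<forall>j\<le>2 * n. mem s1 PAR j = j mod 2)"
    unfolding s1_def
  proof (rule For_rule[where I = "\<lambda>k s. mem s PATH = p \<and> (\<forall>j\<le>k. mem s PAR j = j mod 2)"])
    fix k and s :: state assume "mem s PATH = p \<and> (\<forall>j\<le>k. mem s PAR j = j mod 2)"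
    moreover have "Suc k mod 2 = 1 - k mod 2" by presburger
    ultimately show "mem (exec n (Assign PAR (Plus (Var Xk) (Num 1)) (Minus (Num 1) (Arr PAR (Var Xk)))) (put Xk 0 k s)) PATH = p \<and>
        (\<forall>j\<le>Suc k. mem (exec n (Assign PAR (Plus (Var Xk) (Num 1)) (Minus (Num 1) (Arr PAR (Var Xk)))) (put Xk 0 k s)) PAR j = j mod 2)"
      by (auto simp: mem_put le_Suc_eq)
  qed (use assms in \<open>auto simp: p_def\<close>)
  then have R1: "R s1" by (simp add: R_def)
  have w1: "written s1 = written s" unfolding s1_def by (rule written_exec) simp
  have swap: "exec n (on_swap c) s = (if Suc k < n \<and> even (k + r) then exec n c s else s)"
    if "R s" "mem s Xk 0 = k" "mem s Xr 0 = r" "k < n" "r < n" for c s k r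
  proof -
    have "mem s PAR (k + r) = (k + r) mod 2" using that by (simp add: R_def)
    then show ?thesis
      using that by (auto simp: on_swap_def even_iff_mod_2_eq_zero)
  qed
  \<comment> \<open>The edges met in the first \<open>k\<close> iterations; \<open>min\<close>
    accounts for the disabled last one.\<close>
  define ks where "ks r k = filter (\<lambda>k. even (k + r)) [0..<min k (n - 1)]" for r k
  have ks_Suc: "ks r (Suc k) = (if Suc k < n \<and> even (k + r) then ks r k @ [k] else ks r k)"
    if "k < n" for r k
  proof (cases "Suc k < n")
    case True
    then have "min (Suc k) (n - 1) = Suc k" "min k (n - 1) = k" by auto
    then show ?thesis using True by (simp add: ks_def)
  next
    case False
    then have "min (Suc k) (n - 1) = min k (n - 1)" using that by auto
    then show ?thesis using False by (simp add: ks_def)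
  qed
  have ks_n: "ks r n = filter (\<lambda>k. even (k + r)) [0..<n - 1]" for r
    by (simp add: ks_def min_def)
  define body where "body =
     Set Xx (Num 0) ;;
     For Xk 1 0 (on_swap (Set Xx (Plus (Var Xx) (Num 1)))) ;;
     Put (Var Xx) ;;
     For Xk 1 0 (on_swap (Put (Arr PATH (Plus (Var Xk) (Num 1))) ;;
                          Put (Arr PATH (Plus (Var Xk) (Num 2)))))"
  have body: "R (exec n body s) \<and>
      written (exec n body s) = written s @ encode_round (swap_round n ?h r)"
    if s: "R s" "mem s Xr 0 = r" "r < n" for s r
  proof -
    let ?inc = "on_swap (Set Xx (Plus (Var Xx) (Num 1)))"
    let ?put = "on_swap (Put (Arr PATH (Plus (Var Xk) (Num 1))) ;;
                         Put (Arr PATH (Plus (Var Xk) (Num 2))))"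
    let ?S = "\<lambda>s. R s \<and> mem s Xr 0 = r"
    define s2 where "s2 = exec n (For Xk 1 0 ?inc) (put Xx 0 0 s)"
    have 2: "?S s2 \<and> mem s2 Xx 0 = length (ks r n) \<and> written s2 = written s"
      unfolding s2_def
    proof (rule For_rule[where I = "\<lambda>k s'. ?S s' \<and> mem s' Xx 0 = length (ks r k) \<and>
        written s' = written s"])
      fix k s' assume "k < n" "?S s' \<and> mem s' Xx 0 = length (ks r k) \<and> written s' = written s"
      then show "?S (exec n ?inc (put Xk 0 k s')) \<and>
          mem (exec n ?inc (put Xk 0 k s')) Xx 0 = length (ks r (Suc k)) \<and>
          written (exec n ?inc (put Xk 0 k s')) = written s"
        using swap[of "put Xk 0 k s'" k r] s by (simp add: R_put mem_put ks_Suc)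
    qed (use s in \<open>auto simp: R_put mem_put ks_def\<close>)
    define s3 where "s3 = exec n (Put (Var Xx)) s2"
    have 3: "?S s3 \<and> written s3 = written s @ [length (ks r n)]"
      using 2 by (simp add: s3_def R_def)
    define s4 where "s4 = exec n (For Xk 1 0 ?put) s3"
    have 4: "?S s4 \<and> written s4 = written s3 @ concat (map (\<lambda>k. [?h k, ?h (Suc k)]) (ks r n))"
      unfolding s4_def
    proof (rule For_rule[where I = "\<lambda>k s'. ?S s' \<and>
        written s' = written s3 @ concat (map (\<lambda>k. [?h k, ?h (Suc k)]) (ks r k))"])
      fix k s' assume "k < n" "?S s' \<and>
        written s' = written s3 @ concat (map (\<lambda>k. [?h k, ?h (Suc k)]) (ks r k))"
      then show "?S (exec n ?put (put Xk 0 k s')) \<and> written (exec n ?put (put Xk 0 k s')) =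
          written s3 @ concat (map (\<lambda>k. [?h k, ?h (Suc k)]) (ks r (Suc k)))"
        using swap[of "put Xk 0 k s'" k r] s by (simp add: R_def mem_put ks_Suc)
    qed (use 3 in \<open>auto simp: ks_def\<close>)
    have "exec n body s = s4"
      by (simp add: body_def s4_def s3_def s2_def del: exec.simps(5))
    then show ?thesis
      using 3 4 by (simp add: encode_round_def swap_round_def ks_n comp_def)
  qed
  let ?loop = "For Xr 1 0 (When (Minus (Minus Size (Num 1)) (Var Xr)) body)"
  let ?rounds = "\<lambda>m. concat (map (\<lambda>r. encode_round (swap_round n ?h r)) [0..<min m (n - 1)])"
  define s5 where "s5 = exec n (Put (Minus Size (Num 1))) s1"
  have R5: "R s5" and w5: "written s5 = written s @ [n - 1]"
    using R1 w1 by (simp_all add: s5_def R_def)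
  have "R (exec n ?loop s5) \<and> written (exec n ?loop s5) = written s5 @ ?rounds n"
  proof (rule For_rule[where I = "\<lambda>r s. R s \<and> written s = written s5 @ ?rounds r"])
    fix r s assume r: "r < n" and s: "R s \<and> written s = written s5 @ ?rounds r"
    show "R (exec n (When (Minus (Minus Size (Num 1)) (Var Xr)) body) (put Xr 0 r s)) \<and>
        written (exec n (When (Minus (Minus Size (Num 1)) (Var Xr)) body) (put Xr 0 r s)) =
          written s5 @ ?rounds (Suc r)"
    proof (cases "Suc r < n")
      case True
      then have "min (Suc r) (n - 1) = Suc r" "min r (n - 1) = r" by auto
      then show ?thesis using body[of "put Xr 0 r s" r] r s True by (simp add: R_put mem_put)
    next
      case False
      then have "min (Suc r) (n - 1) = min r (n - 1)" using r by auto
      then show ?thesis using s False by (simp add: R_put mem_put)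
    qed
  qed (use R5 in auto)
  moreover have "exec n emit_rounds s = exec n ?loop s5"
    by (simp add: emit_rounds_def Let_def s5_def s1_def body_def on_swap_def del: exec.simps(5))
  ultimately show ?thesis
    using w5 by (simp add: encode_strategy_def swap_rounds_def p_def comp_def min_def)
qed

section \<open>From acquaintance time one to a Hamiltonian path\<close>

lemma swap_along_edge:
  assumes "pairwise disjnt M" "{x, y} \<in> M"
  shows "swap_along M x = y"
proof -
  have "z = y" if "{x, z} \<in> M" for z
  proof (rule ccontr)
    assume "z \<noteq> y"
    then have "{x, z} \<noteq> {x, y}" by (auto simp: doubleton_eq_iff)
    then show False using pairwiseD[OF assms(1) that assms(2)] by (simp add: disjnt_def)
  qed
  then have "(THE z. {x, z} \<in> M) = y" using assms(2) by (intro the_equality)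
  moreover have "\<exists>z. {x, z} \<in> M" using assms(2) by blast
  ultimately show ?thesis unfolding swap_along_def by (simp only: if_True)
qed

lemma swap_along_bij:
  assumes "simple_graph V E" "graph_matching E M"
  shows "bij_betw (swap_along M) V V"
proof -
  have M: "M \<subseteq> E" "pairwise disjnt M" using assms(2) by (auto simp: graph_matching_def)
  have *: "swap_along M x \<in> V \<and> swap_along M (swap_along M x) = x" if "x \<in> V" for x
  proof (cases "\<exists>y. {x, y} \<in> M")
    case True
    then obtain y where y: "{x, y} \<in> M" by blast
    then obtain u v where "u \<in> V" "v \<in> V" "{x, y} = {u, v}"
      using M(1) assms(1) unfolding simple_graph_def by blast
    then have "y \<in> V" by (auto simp: doubleton_eq_iff)
    moreover have "{y, x} \<in> M" using y by (simp add: insert_commute)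
    ultimately show ?thesis using swap_along_edge[OF M(2)] y by auto
  next
    case False
    then show ?thesis using that by (simp add: swap_along_def)
  qed
  show ?thesis by (rule bij_betw_byWitness[of V "swap_along M" "swap_along M"]) (use * in auto)
qed

text \<open>A strategy exists, since otherwise the infimum would be infinite. The infimum is then
  attained, by a strategy with a single matching, whose swap map is \<open>\<sigma>\<close>.\<close>

lemma swap_graph_if_AC_1:
  assumes G: "simple_graph V E" and AC: "AC V E = 1"
  obtains \<sigma> where "swap_graph V (\<lambda>a b. {a, b} \<in> E) \<sigma>"
proof -
  let ?S = "{Ms. acquaintance_strategy V E Ms}"
  have "?S \<noteq> {}"
  proof
    assume "?S = {}"
    then have "AC V E = \<infinity>"
      unfolding AC_def by (simp only: image_empty Inf_empty top_enat_def)
    with AC show False by simp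
  qed
  then obtain Ms\<^sub>0 where "Ms\<^sub>0 \<in> ?S" by blast
  then have "AC V E \<in> (\<lambda>Ms. enat (length Ms)) ` ?S"
    unfolding AC_def by (intro wellorder_InfI[OF imageI])
  then obtain Ms where Ms: "acquaintance_strategy V E Ms" "length Ms = 1"
    using AC by (auto simp: one_enat_def)
  then obtain M where M: "Ms = [M]" by (cases Ms) auto
  have match: "graph_matching E M" using Ms(1) M by (simp add: acquaintance_strategy_def)
  have "{a, b} \<in> E \<or> {swap_along M a, swap_along M b} \<in> E"
    if "a \<in> V" "b \<in> V" "a \<noteq> b" for a b
  proof -
    have "acquainted E [M] a b" using Ms(1) that by (simp add: acquaintance_strategy_def M)
    then obtain k where k: "k \<le> 1" "{position (take k [M]) a, position (take k [M]) b} \<in> E"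
      by (auto simp: acquainted_def)
    then consider "k = 0" | "k = 1" by linarith
    then show ?thesis using k(2) by cases (simp_all add: position_def)
  qed
  then have "swap_graph V (\<lambda>a b. {a, b} \<in> E) (swap_along M)"
    using G swap_along_bij[OF G match]
    by unfold_locales (auto simp: simple_graph_def insert_commute)
  then show ?thesis by (rule that)
qed

definition adjacency :: "nat set set \<Rightarrow> nat \<Rightarrow> nat \<Rightarrow> nat" where
  "adjacency E i j = (if {i, j} \<in> E then 1 else 0)"

lemma row_count_le: "row_count n f u \<le> n"
proof -
  have "row_count n f u \<le> card {..<n}" unfolding row_count_def by (intro card_mono) auto
  then show ?thesis by simp
qed

text \<open>The universal vertex \<open>n\<close> is a heavy partner of both ends and raises the
  bound \<open>n - 1\<close> of \<open>heavy_sum\<close> to \<open>n + 1\<close>.\<close>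

lemma two_opt_weight_matrix:
  assumes G: "simple_graph {..<n} E" and sg: "swap_graph {..<n} (\<lambda>a b. {a, b} \<in> E) \<sigma>" and n: "0 < n"
  shows "two_opt (Suc n) (2 * n + 2) (weight_matrix n (adjacency E))"
proof -
  interpret swap_graph "{..<n}" "\<lambda>a b. {a, b} \<in> E" \<sigma> by (fact sg)
  let ?W = "weight_matrix n (adjacency E)"
  have sym_ext: "extended n (adjacency E) u v = extended n (adjacency E) v u" for u v
    by (simp add: extended_def adjacency_def insert_commute)
  have "{u, u} \<notin> E" for u
    using G unfolding simple_graph_def by (metis doubleton_eq_iff)
  then have "{v. v < n \<and> adjacency E u v \<noteq> 0} = {w \<in> {..<n} - {u}. {u, w} \<in> E}" for u
    by (auto simp: adjacency_def)
  then have "row_count n (adjacency E) u = deg u" for u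
    by (simp add: row_count_def deg_def)
  then have W: "?W u v = weight u v" if "u < n" "v < n" for u v
    using that by (simp add: weight_matrix_def weight_def extended_def adjacency_def)
  have heavy: "Suc (card (heavy c u)) \<le> card {w. w < Suc n \<and> w \<noteq> u \<and> c < ?W u w}"
    if "u < n" "c < 2 * n + 2" for u c
  proof -
    have "card (insert n (heavy c u)) \<le> card {w. w < Suc n \<and> w \<noteq> u \<and> c < ?W u w}"
      using that by (intro card_mono)
        (auto simp: heavy_def W, simp add: weight_matrix_def extended_def)
    moreover have "n \<notin> heavy c u" "finite (heavy c u)" by (simp_all add: heavy_def)
    ultimately show ?thesis by simp
  qed
  show ?thesis
  proof
    show "2 \<le> Suc n" using n by simp
    show "?W u v = ?W v u" for u v
      using sym_ext[of u v] by (simp add: weight_matrix_def)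
    show "Suc n \<le> card {w. w < Suc n \<and> w \<noteq> u \<and> ?W u v < ?W u w} +
        card {w. w < Suc n \<and> w \<noteq> v \<and> ?W u v < ?W v w}"
      if "u < Suc n" "v < Suc n" "u \<noteq> v" "?W u v < 2 * n + 2" for u v
    proof -
      \<comment> \<open>A weight below \<open>2 * n + 2\<close> means that the pair is nonadjacent
        and avoids the universal vertex.\<close>
      have uv: "u < n" "v < n" "extended n (adjacency E) u v = 0"
        using that(4) by (auto simp: weight_matrix_def extended_def split: if_splits)
      define c where "c = ?W u v"
      have "c \<le> 2 * n"
        using uv(3) row_count_le[of n "adjacency E" u] row_count_le[of n "adjacency E" v]
        by (simp add: c_def weight_matrix_def)
      then have "n - 1 \<le> card (heavy c u) + card (heavy c v)"
        using heavy_sum[of u v c] uv that(3) W[of u v] by (simp add: c_def)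
      then show ?thesis
        using heavy[OF uv(1), of c] heavy[OF uv(2), of c] that(4) by (simp add: c_def)
    qed
  qed
qed

text \<open>The universal vertex stays at positions 0 and \<open>Suc n\<close>, so the positions
  between them carry the path; the shift by one in \<open>h\<close> deletes it.\<close>

lemma ham_path_optimize:
  assumes to: "two_opt (Suc n) (2 * n + 2) (weight_matrix n (adjacency E))"
    and p: "two_opt.tour (Suc n) p" "p 0 = n"
  defines "h \<equiv> \<lambda>k. two_opt.optimize (Suc n) (2 * n + 2) (weight_matrix n (adjacency E)) p (Suc k)"
  shows "ham_path n h E" "h ` {..<n} = {..<n}"
proof -
  interpret two_opt "Suc n" "2 * n + 2" "weight_matrix n (adjacency E)" by (fact to)
  define q where "q = optimize p"
  have q: "tour q" "\<And>k. k < Suc n \<Longrightarrow> 2 * n + 2 \<le> weight_matrix n (adjacency E) (q k) (q (Suc k))"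
    using optimize_level[OF p(1)] by (auto simp: q_def level_def)
  have inj: "inj_on h {..<Suc n}" using tour_inj(2)[OF q(1)] by (simp add: h_def q_def)
  have last: "h n = n" using q(1) optimize_0[of p] p(2) by (simp add: tour_def h_def q_def)
  have less: "h k < n" if "k < n" for k
  proof -
    have "h k < Suc n" using tour_less[OF q(1), of "Suc k"] that by (simp add: h_def q_def)
    moreover have "h k \<noteq> h n" using inj_onD[OF inj, of k n] that by auto
    ultimately show ?thesis using last by simp
  qed
  show "ham_path n h E"
  proof
    show "inj_on h {..<n}" using inj by (rule inj_on_subset) auto
    show "{h k, h (Suc k)} \<in> E" if "Suc k < n" for k
    proof -
      have "2 * n + 2 \<le> weight_matrix n (adjacency E) (h k) (h (Suc k))"
        using q(2)[of "Suc k"] that by (simp add: h_def q_def)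
      \<comment> \<open>A degree sum is at most \<open>2 * n\<close>, so only an edge can weigh
        \<open>2 * n + 2\<close>.\<close>
      then have "extended n (adjacency E) (h k) (h (Suc k)) \<noteq> 0"
        using row_count_le[of n "adjacency E" "h k"] row_count_le[of n "adjacency E" "h (Suc k)"]
        by (auto simp: weight_matrix_def split: if_splits)
      then show ?thesis
        using less[of k] less[of "Suc k"] that by (auto simp: extended_def adjacency_def split: if_splits)
    qed
  qed
  then show "h ` {..<n} = {..<n}"
    using less by (intro endo_inj_surj) (auto simp: ham_path_def)
qed

definition solver :: com where
  "solver = load_matrix ;; compute_weights ;; init_path ;; optimize_path ;; emit_rounds"

lemma wf_solver: "wf_com solver"
  by (simp add: solver_def load_matrix_def compute_weights_def init_path_def optimize_path_def
      try_move_def reverse_path_def emit_rounds_def Let_def)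

lemma encode_graph_eq:
  "encode_graph n E = n # concat (map (\<lambda>i. map (adjacency E i) [0..<n]) [0..<n])"
  by (simp add: encode_graph_def adjacency_def[abs_def])

lemma solver_correct:
  assumes G: "simple_graph {..<n} E" and n: "0 < n" and AC: "AC {..<n} E = 1"
  obtains rs where
    "written (exec n solver (start (concat (map (\<lambda>i. map (adjacency E i) [0..<n]) [0..<n])))) =
      encode_strategy rs"
    "length rs = n - 1" "acquaintance_strategy {..<n} E (map round_matching rs)"
proof -
  let ?f = "adjacency E"
  obtain \<sigma> where "swap_graph {..<n} (\<lambda>a b. {a, b} \<in> E) \<sigma>"
    using swap_graph_if_AC_1[OF G AC] .
  then have to: "two_opt (Suc n) (2 * n + 2) (weight_matrix n ?f)"
    using two_opt_weight_matrix[OF G _ n] by blast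
  interpret two_opt "Suc n" "2 * n + 2" "weight_matrix n ?f" by (fact to)
  define s0 where "s0 = start (concat (map (\<lambda>i. map (?f i) [0..<n]) [0..<n]))"
  define s1 where "s1 = exec n load_matrix s0"
  define s2 where "s2 = exec n compute_weights s1"
  define s3 where "s3 = exec n init_path s2"
  define s4 where "s4 = exec n optimize_path s3"
  have writes: "writes load_matrix = {Xu, Xv, Xx, Xy, ADJ, ROW}"
    "writes compute_weights = {Xu, Xv, DEG, WGT}" "writes init_path = {Xk, PATH}"
    "writes optimize_path = {Xc, Xr, Xi, Xj, Xk, COPY, PATH}"
    by (auto simp: load_matrix_def compute_weights_def init_path_def optimize_path_def
        writes_try_move)
  have s0: "mem s0 a = (\<lambda>_. 0)" for a by (simp add: s0_def start_def)
  have 1: "rows n s1" "stores n ADJ (extended n ?f) s1"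
    using load_matrix_correct[of s0 ?f n] s0 by (simp_all add: s1_def s0_def start_def)
  have "mem s1 DEG = (\<lambda>_. 0)" unfolding s1_def by (subst mem_exec) (simp_all add: writes s0)
  then have 2: "stores n WGT (weight_matrix n ?f) s2"
    using compute_weights_correct[OF 1] by (simp add: s2_def)
  have "mem s3 ROW = mem s1 ROW" "mem s3 WGT = mem s2 WGT"
    by (simp_all add: s3_def s2_def mem_exec writes)
  then have 3: "rows n s3" "stores n WGT (weight_matrix n ?f) s3"
    using 1 2 by (simp_all add: rows_def stores_def)
  define p where "p = mem s3 PATH"
  have p: "p 0 = n" "\<And>k. k \<le> n \<Longrightarrow> p (Suc k) = k"
    using init_path_correct[of n s2] by (simp_all add: p_def s3_def)
  have p': "p k = (if k = 0 then n else k - 1)" if "k \<le> Suc n" for k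
    using p(1) p(2)[of "k - 1"] that by (cases k) auto
  have tour: "tour p"
    unfolding tour_def by (auto simp: inj_on_def p')
  have 4: "mem s4 PATH = optimize p"
    using optimize_path_correct[OF refl refl, of s3] 3 tour by (simp add: s4_def ready_def p_def)
  define h where "h k = optimize p (Suc k)" for k
  have "mem s4 PAR = (\<lambda>_. 0)"
    by (simp add: s4_def s3_def s2_def s1_def mem_exec writes s0)
  then have "written (exec n emit_rounds s4) = written s4 @ encode_strategy (swap_rounds n h)"
    using emit_rounds_correct[of s4 n] by (simp add: 4 h_def[abs_def])
  moreover have "written s4 = []"
    by (simp add: s4_def s3_def s2_def s1_def s0_def written_exec load_matrix_def compute_weights_def
        init_path_def optimize_path_def try_move_def reverse_path_def start_def Let_def
        del: exec.simps)
  ultimately have "written (exec n solver s0) = encode_strategy (swap_rounds n h)"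
    by (simp add: solver_def s4_def s3_def s2_def s1_def)
  moreover have "length (swap_rounds n h) = n - 1" by (simp add: swap_rounds_def)
  moreover have "ham_path n h E" "h ` {..<n} = {..<n}"
    using ham_path_optimize[OF to tour p(1)] by (simp_all add: h_def[abs_def])
  then have "acquaintance_strategy {..<n} E (map round_matching (swap_rounds n h))"
    by (rule ham_path.acquaintance_strategy_swap_rounds)
  ultimately show ?thesis using that unfolding s0_def by blast
qed

theorem theorem7p5:
  "\<exists>P :: instr list.
     poly_time_on P {encode_graph n E | n E. simple_graph {..<n} E} \<and>
     (\<forall>(n :: nat) (E :: nat set set).
        simple_graph {..<n} E \<and> connected_graph {..<n} E \<and> AC {..<n} E = 1 \<longrightarrow>
        (\<exists>rs :: (nat \<times> nat) list list.
           outputs P (encode_graph n E) (encode_strategy rs) \<and>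
           length rs = n - 1 \<and>
           acquaintance_strategy {..<n} E (map round_matching rs)))"
proof (intro exI[of _ "program solver"] conjI allI impI)
  \<comment> \<open>The summand 1 pays for reading the size parameter.\<close>
  let ?p = "1 + com_cost solver"
  have "\<exists>t\<le>poly ?p (length (encode_graph n E)). halted (program solver) (run (program solver) (encode_graph n E) t)"
    for n E
  proof -
    let ?xs = "concat (map (\<lambda>i. map (adjacency E i) [0..<n]) [0..<n])"
    obtain t where t: "t \<le> 1 + poly (com_cost solver) n"
      "halted (program solver) (run (program solver) (n # ?xs) t)"
      using program_correct[OF wf_solver, of n ?xs] by blast
    have "length ?xs = n * n" by (simp add: length_concat comp_def sum_list_triv)
    then have "n \<le> length (n # ?xs)" using le_SucI[OF le_square[of n]] by simp
    from poly_nat_mono[OF this, of "com_cost solver"] t show ?thesis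
      unfolding encode_graph_eq by (intro exI[of _ t]) simp
  qed
  then show "poly_time_on (program solver) {encode_graph n E | n E. simple_graph {..<n} E}"
    unfolding poly_time_on_def by blast
next
  fix n :: nat and E :: "nat set set"
  assume *: "simple_graph {..<n} E \<and> connected_graph {..<n} E \<and> AC {..<n} E = 1"
  then have "0 < n" by (auto simp: connected_graph_def)
  then obtain rs where rs:
    "written (exec n solver (start (concat (map (\<lambda>i. map (adjacency E i) [0..<n]) [0..<n])))) =
      encode_strategy rs"
    "length rs = n - 1" "acquaintance_strategy {..<n} E (map round_matching rs)"
    using solver_correct[of n E] * by blast
  have "outputs (program solver) (encode_graph n E) (encode_strategy rs)"
    unfolding outputs_def encode_graph_eq rs(1)[symmetric] using program_correct[OF wf_solver] by blast
  then show "\<exists>rs. outputs (program solver) (encode_graph n E) (encode_strategy rs) \<and>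
      length rs = n - 1 \<and> acquaintance_strategy {..<n} E (map round_matching rs)"
    using rs by blast
qed

end
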